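(* Let $X$ be a separable commutative $F$-algebra that supports a dense freely generated subalgebra, and let $T$ be an operator on $X$. Suppose there exist a function $E:\mathbb{C}\to X$ and an entire function $\phi:\mathbb{C}\to\mathbb{C}$ satisfying the following: (a) for each $\lambda\in\mathbb{C}$, $TE(\lambda)=\phi(\lambda)E(\lambda)$; (b) for each $\lambda,\mu\in\mathbb{C}$, $E(\lambda)E(\mu)=E(\lambda+\mu)$; (c) for each subset $\Lambda$ of $\mathbb{C}$ having an accumulation point in $\mathbb{C}$, the set $\{E(\lambda):\lambda\in\Lambda\}$ has dense linear span in $X$; and (d) $|\phi(0)|=1$, $\phi''(0)\phi(0)\neq\phi'(0)^2$, and $\phi'(0)\neq0$. Then the generic element $f=(f_n)_{n=1}^\infty$ of $X^{\mathbb{N}}$ freely generates a dense subalgebra of $X$ consisting entirely (but zero) of hypercyclic vectors for $T$.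
   Context: An $F$-algebra is a (complex) topological algebra whose underlying topological vector space is an $F$-space (completely metrizable by a translation-invariant metric). An operator on $X$ is a continuous linear map $X\to X$ (not assumed multiplicative). A vector $x$ is hypercyclic for $T$ if $\{T^nx:n\ge0\}$ is dense in $X$. A set of elements of a commutative algebra is a set of free generators (and the subalgebra it generates is freely generated) if $P(g_1,\dots,g_k)\neq0$ for any distinct elements $g_1,\dots,g_k$ of the set and every nonzero polynomial $P$ in $k$ commuting variables without constant term; the subalgebra generated by the set consists of all such $P(g_1,\dots,g_k)$ together with $0$. $X^{\mathbb{N}}$ carries the product topology. A statement holds for the generic element of an $F$-space $Y$ if it holds at each element of some dense $G_\delta$ subset of $Y$. *)

theory Defs
  imports
    "HOL-Complex_Analysis.Complex_Analysis"
    "HOL-Library.Poly_Mapping"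
begin

text \<open>
  The distribution has no type class of complex vector spaces, so the complex scalar multiplication
  is an explicit parameter. The class \<^class>\<open>comm_ring\<close> does not postulate a unit.
\<close>

locale F_space = vector_space smul
  for smul :: "complex \<Rightarrow> 'a \<Rightarrow> 'a :: {ab_group_add, topological_space}" +
  assumes continuous_add: "continuous_on UNIV (\<lambda>(x::'a, y). x + y)"
    and continuous_smul: "continuous_on UNIV (\<lambda>(c, x). smul c x)"
    and complete_invariant_metric:
      "\<exists>d :: 'a \<Rightarrow> 'a \<Rightarrow> real. Metric_space UNIV d
         \<and> Metric_space.mtopology UNIV d = euclidean
         \<and> Metric_space.mcomplete UNIV d
         \<and> (\<forall>x y z. d (x + z) (y + z) = d x y)"

locale commutative_F_algebra = F_space smul
  for smul :: "complex \<Rightarrow> 'a \<Rightarrow> 'a :: {comm_ring, topological_space}" +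
  assumes smul_mult_left: "smul c (x * y) = smul c x * y"
    and continuous_mult: "continuous_on UNIV (\<lambda>(x::'a, y). x * y)"

definition dense_set :: "'a :: topological_space set \<Rightarrow> bool" where
  "dense_set S \<longleftrightarrow> closure S = UNIV"

text \<open>
  Polynomials are finitely supported functions from exponent vectors to coefficients, with variables
  indexed by natural numbers; those in \<open>k\<close> variables only involve the variables \<open>0, \<dots>, k - 1\<close>.
\<close>

type_synonym cpoly = "(nat \<Rightarrow>\<^sub>0 nat) \<Rightarrow>\<^sub>0 complex"

definition polys_without_constant_term :: "nat \<Rightarrow> cpoly set" where
  "polys_without_constant_term k =
     {P. Poly_Mapping.lookup P 0 = 0
       \<and> (\<forall>m \<in> Poly_Mapping.keys P. Poly_Mapping.keys m \<subseteq> {..<k})}"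

text \<open>
  As the algebra need not have a unit, only products of nonempty lists are meaningful; the value on
  the empty list is never used for a polynomial without constant term.
\<close>

fun prod_nonempty :: "'a :: comm_ring list \<Rightarrow> 'a" where
  "prod_nonempty [] = 0"
| "prod_nonempty [x] = x"
| "prod_nonempty (x # y # xs) = x * prod_nonempty (y # xs)"

definition eval_monomial :: "'a :: comm_ring list \<Rightarrow> (nat \<Rightarrow>\<^sub>0 nat) \<Rightarrow> 'a" where
  "eval_monomial gs m =
     prod_nonempty (concat (map (\<lambda>i. replicate (Poly_Mapping.lookup m i) (gs ! i)) [0..<length gs]))"

definition eval_cpoly :: "(complex \<Rightarrow> 'a \<Rightarrow> 'a) \<Rightarrow> cpoly \<Rightarrow> 'a :: comm_ring list \<Rightarrow> 'a" where
  "eval_cpoly smul P gs =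
     (\<Sum>m \<in> Poly_Mapping.keys P. smul (Poly_Mapping.lookup P m) (eval_monomial gs m))"

definition free_generators :: "(complex \<Rightarrow> 'a \<Rightarrow> 'a) \<Rightarrow> 'a :: comm_ring set \<Rightarrow> bool" where
  "free_generators smul S \<longleftrightarrow>
     (\<forall>gs. distinct gs \<and> set gs \<subseteq> S \<longrightarrow>
        (\<forall>P \<in> polys_without_constant_term (length gs). P \<noteq> 0 \<longrightarrow> eval_cpoly smul P gs \<noteq> 0))"

definition generated_subalgebra :: "(complex \<Rightarrow> 'a \<Rightarrow> 'a) \<Rightarrow> 'a :: comm_ring set \<Rightarrow> 'a set" where
  "generated_subalgebra smul S =
     {eval_cpoly smul P gs | P gs.
        distinct gs \<and> set gs \<subseteq> S \<and> P \<in> polys_without_constant_term (length gs)}"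

text \<open>
  A free generating set is required to be nonempty. This only excludes the zero subalgebra, which is
  dense exactly when the whole algebra is zero.
\<close>

definition freely_generated_subalgebra :: "(complex \<Rightarrow> 'a \<Rightarrow> 'a) \<Rightarrow> 'a :: comm_ring set \<Rightarrow> bool" where
  "freely_generated_subalgebra smul A \<longleftrightarrow>
     (\<exists>S. S \<noteq> {} \<and> free_generators smul S \<and> A = generated_subalgebra smul S)"

text \<open>A sequence freely generates if its entries are pairwise distinct free generators.\<close>

definition freely_generates :: "(complex \<Rightarrow> 'a \<Rightarrow> 'a) \<Rightarrow> (nat \<Rightarrow> 'a :: comm_ring) \<Rightarrow> bool" where
  "freely_generates smul f \<longleftrightarrow> inj f \<and> free_generators smul (range f)"

definition continuous_operator ::
    "(complex \<Rightarrow> 'a \<Rightarrow> 'a) \<Rightarrow> ('a :: {ab_group_add, topological_space} \<Rightarrow> 'a) \<Rightarrow> bool" where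
  "continuous_operator smul T \<longleftrightarrow> Vector_Spaces.linear smul smul T \<and> continuous_on UNIV T"

definition hypercyclic :: "('a :: topological_space \<Rightarrow> 'a) \<Rightarrow> 'a \<Rightarrow> bool" where
  "hypercyclic T x \<longleftrightarrow> dense_set {(T ^^ n) x | n. True}"

definition generically :: "('a :: topological_space \<Rightarrow> bool) \<Rightarrow> bool" where
  "generically Q \<longleftrightarrow> (\<exists>G. gdelta_in euclidean G \<and> dense_set G \<and> (\<forall>x \<in> G. Q x))"

end

theory Submission
  imports Defs
begin

text \<open>
The sets of the Baire category argument only involve monomials. Let a nonzero polynomial without
constant term be given, and let \<open>w\<close> be its leading monomial, meaning one of maximal degree that is
exposed among those by a linear functional of the exponents (\<open>leading_monomial_dominates\<close>). If for
all open \<open>V \<noteq> {}\<close> and all neighbourhoods \<open>Z\<close> of zero some iterate \<open>T\<^sup>n\<close> maps the monomial \<open>w\<close> in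
\<open>f\<close> into \<open>V\<close> and all the other monomials into \<open>Z\<close>, then the value of the polynomial at \<open>f\<close> is
hypercyclic, whatever its coefficients (\<open>combination_hypercyclic\<close>). Each instance of this condition
is open in \<open>f\<close>, and countably many instances suffice. Hypercyclic vectors are nonzero when \<open>X\<close> is, which
holds because a free generator is nonzero; so such an \<open>f\<close> freely generates its algebra. The
algebra is dense as soon as the entries of \<open>f\<close> form a dense set, which is a generic property too.

What remains is density of each of these conditions (\<open>simultaneous_orbits\<close>). Let \<open>d\<close> be the
degree of \<open>w\<close>. Approximate a given sequence by one with entries \<open>A\<^sub>i\<close> in the span of the \<open>E(\<gamma>)\<close>, and
approximate the target by \<open>\<Sum>b(\<mu>) E(d \<mu>)\<close>, with \<open>\<gamma> \<in> \<Gamma>\<close> and \<open>\<mu> \<in> \<Lambda>\<close>, and consider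
\<open>f\<^sub>i = A\<^sub>i + exp (n \<epsilon> c\<^sub>i) \<Sum>b(\<mu>)\<^bsup>1/d\<^esup> \<phi>(d \<mu>)\<^bsup>- n/d\<^esup> E(\<mu>)\<close>.
If \<open>\<bar>\<phi>(d \<mu>)\<bar> > 1\<close> and \<open>\<epsilon>\<close> is small the added terms tend to zero. In the expansion of a monomial every
product of eigenvectors is an eigenvector \<open>E(\<sigma>)\<close>, with \<open>\<sigma>\<close> the sum of the exponents involved, and
\<open>T\<^sup>n\<close> multiplies it by \<open>\<phi>(\<sigma>)\<^sup>n\<close>. The product of \<open>d\<close> terms with the same \<open>\<mu>\<close> gives exactly
\<open>b(\<mu>) E(d \<mu>)\<close>, up to the factors \<open>exp (n \<epsilon> c\<^sub>i)\<close>, which cancel for \<open>w\<close> and tend to zero for the other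
monomials of degree \<open>d\<close>. All other products must decay geometrically, and this is a property of the
function \<open>u = ln \<bar>\<phi>\<bar>\<close> alone (\<open>dominated_exponents\<close>).

The conditions on \<open>\<phi>\<close> say that \<open>u\<close> is harmonic near the origin with \<open>u(0) = 0\<close>, with nonzero gradient
there, and with nonzero second derivative in the sense of \<open>(ln \<phi>)''(0) \<noteq> 0\<close>. As a harmonic function \<open>u\<close>
then has a direction of strict convexity; the set \<open>\<Lambda>\<close> is taken on that ray, where Jensen's inequality
gives \<open>u(\<mu>\<^sub>1 + \<dots> + \<mu>\<^sub>k) < (u(d \<mu>\<^sub>1) + \<dots> + u(d \<mu>\<^sub>k)) / d\<close> for \<open>k \<le> d\<close>, except for \<open>d\<close> equal
exponents. The set \<open>\<Gamma>\<close> is taken on a ray along which \<open>u\<close> is negative, and very close to the origin,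
so that products involving both kinds of exponents decay as well. Both rays accumulate at the origin,
which makes the spans of the eigenvectors dense.
\<close>

section \<open>The modulus of an entire function near a point of modulus one\<close>

lemma local_logarithm:
  fixes \<phi> :: "complex \<Rightarrow> complex"
  assumes hol: "\<phi> holomorphic_on UNIV" and nz: "\<phi> 0 \<noteq> 0"
  obtains R h where "R > 0" "h holomorphic_on ball 0 R" "\<And>z. z \<in> ball 0 R \<Longrightarrow> \<phi> z = exp (h z)"
    "deriv h 0 = deriv \<phi> 0 / \<phi> 0"
    "deriv (deriv h) 0 = (deriv (deriv \<phi>) 0 * \<phi> 0 - (deriv \<phi> 0)\<^sup>2) / (\<phi> 0)\<^sup>2"
proof -
  have "isCont \<phi> 0"
    using hol holomorphic_on_imp_continuous_on continuous_on_eq_continuous_at open_UNIV by blast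
  then obtain R where R: "R > 0" "\<And>z. z \<in> ball 0 R \<Longrightarrow> \<phi> z \<noteq> 0"
    using continuous_at_avoid[of 0 \<phi> 0] nz by auto
  have "contractible (ball (0::complex) R)"
    by (simp add: convex_imp_contractible)
  then obtain h where h: "h holomorphic_on ball 0 R" "\<And>z. z \<in> ball 0 R \<Longrightarrow> \<phi> z = exp (h z)"
    using contractible_imp_holomorphic_log[of \<phi> "ball 0 R"] hol R(2)
      holomorphic_on_subset by (metis subset_UNIV)
  have dh: "(h has_field_derivative deriv h z) (at z)" if "z \<in> ball 0 R" for z
    using h(1) holomorphic_derivI open_ball that by blast
  have d\<phi>: "deriv h z = deriv \<phi> z / \<phi> z" if z: "z \<in> ball 0 R" for z
  proof -
    have "((\<lambda>z. exp (h z)) has_field_derivative exp (h z) * deriv h z) (at z)"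
      by (rule DERIV_fun_exp[OF dh[OF z]])
    moreover have "eventually (\<lambda>y. exp (h y) = \<phi> y) (nhds z)"
      using eventually_nhds_in_open[OF open_ball z] by eventually_elim (simp add: h(2))
    ultimately have "(\<phi> has_field_derivative exp (h z) * deriv h z) (at z)"
      using DERIV_cong_ev[of z z "\<lambda>z. exp (h z)" \<phi> "exp (h z) * deriv h z"] by simp
    then have "deriv \<phi> z = \<phi> z * deriv h z"
      using h(2)[OF z] DERIV_imp_deriv by fastforce
    then show ?thesis using R(2)[OF z] by simp
  qed
  have 0: "0 \<in> ball (0::complex) R" using R(1) by simp
  have "eventually (\<lambda>z. deriv h z = deriv \<phi> z / \<phi> z) (nhds 0)"
    using eventually_nhds_in_open[OF open_ball 0] by eventually_elim (simp add: d\<phi>)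
  then have "deriv (deriv h) 0 = deriv (\<lambda>z. deriv \<phi> z / \<phi> z) 0"
    by (rule deriv_cong_ev) simp
  also have "\<dots> = (deriv (deriv \<phi>) 0 * \<phi> 0 - deriv \<phi> 0 * deriv \<phi> 0) / (\<phi> 0)\<^sup>2"
    using hol nz
    by (intro deriv_divide) (auto intro: holomorphic_on_imp_differentiable_at holomorphic_deriv)
  finally show ?thesis
    using that[of R h] R(1) h d\<phi>[OF 0] by (simp add: power2_eq_square)
qed

lemma has_real_derivative_Re_ray:
  assumes "(h has_field_derivative h') (at (of_real t * v))"
  shows "((\<lambda>t. Re (h (of_real t * v))) has_real_derivative Re (h' * v)) (at t)"
proof -
  have "((\<lambda>t. complex_of_real t * v) has_vector_derivative v) (at t)"
    by (auto intro!: derivative_eq_intros)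
  from field_vector_diff_chain_at[OF this assms]
  have "((\<lambda>t. h (complex_of_real t * v)) has_vector_derivative (v * h')) (at t)"
    by (simp add: o_def)
  then show ?thesis
    unfolding has_real_derivative_iff_has_vector_derivative
    using bounded_linear.has_vector_derivative[OF bounded_linear_Re] by (fastforce simp: mult.commute)
qed

lemma convex_on_eq:
  assumes "convex_on S f" "\<And>x. x \<in> S \<Longrightarrow> g x = f x"
  shows "convex_on S g"
  using assms by (auto simp: convex_on_def convexD)

text \<open>
Near the origin \<open>\<phi> = exp \<circ> h\<close>, and \<open>h''(0) \<noteq> 0\<close> says exactly that \<open>\<phi>''(0) \<phi>(0) \<noteq> \<phi>'(0)\<^sup>2\<close>. In the
direction \<open>v\<close> with \<open>h''(0) v\<^sup>2 = 1\<close> the function \<open>ln \<bar>\<phi>\<bar> = Re h\<close> has second derivative \<open>1\<close> at the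
origin, hence at least \<open>1/2\<close> nearby. Replacing \<open>v\<close> by \<open>- v\<close> if necessary, its first derivative at
the origin is nonnegative; since \<open>\<bar>\<phi>(0)\<bar> = 1\<close>, it follows that \<open>ln \<bar>\<phi>\<bar>\<close> is positive on the ray. Strict
convexity is recorded as convexity after the subtraction of \<open>t\<^sup>2 / 4\<close>, so that a quantitative gap
survives in Jensen's inequality.
\<close>

lemma expanding_strictly_convex_ray:
  fixes \<phi> :: "complex \<Rightarrow> complex"
  assumes hol: "\<phi> holomorphic_on UNIV" and norm0: "norm (\<phi> 0) = 1"
    and curv: "deriv (deriv \<phi>) 0 * \<phi> 0 \<noteq> (deriv \<phi> 0)\<^sup>2"
  obtains v R where "R > 0" "v \<noteq> 0" "\<forall>t\<in>{0..R}. \<phi> (of_real t * v) \<noteq> 0"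
    "\<forall>t\<in>{0<..R}. norm (\<phi> (of_real t * v)) > 1"
    "convex_on {0..R} (\<lambda>t. ln (norm (\<phi> (of_real t * v))) - t\<^sup>2 / 4)"
proof -
  have nz: "\<phi> 0 \<noteq> 0" using norm0 by auto
  obtain r h where r: "r > 0" and h: "h holomorphic_on ball 0 r"
      "\<And>z. z \<in> ball 0 r \<Longrightarrow> \<phi> z = exp (h z)"
    and h2: "deriv (deriv h) 0 = (deriv (deriv \<phi>) 0 * \<phi> 0 - (deriv \<phi> 0)\<^sup>2) / (\<phi> 0)\<^sup>2"
    using local_logarithm[OF hol nz] by metis
  define H where "H = deriv (deriv h) 0"
  have Hnz: "H \<noteq> 0" using curv nz unfolding H_def h2 by simp
  define v0 where "v0 = 1 / csqrt H"
  define v where "v = (if Re (deriv h 0 * v0) \<ge> 0 then v0 else - v0)"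
  have v2: "H * v * v = 1"
    using Hnz by (simp add: v_def v0_def divide_simps flip: power2_eq_square)
  have vnz: "v \<noteq> 0" using v2 by auto
  have slope: "Re (deriv h 0 * v) \<ge> 0" by (simp add: v_def)
  define p where "p t = Re (h (of_real t * v))" for t
  define p1 where "p1 t = Re (deriv h (of_real t * v) * v)" for t
  define p2 where "p2 t = Re (deriv (deriv h) (of_real t * v) * v * v)" for t
  have h': "deriv h holomorphic_on ball 0 r" "deriv (deriv h) holomorphic_on ball 0 r"
    using h(1) by (simp_all add: holomorphic_deriv)
  have in_ball: "of_real t * v \<in> ball 0 r" if "\<bar>t\<bar> < r / norm v" for t
    using that vnz by (simp add: norm_mult pos_less_divide_eq)
  have dp: "(p has_real_derivative p1 t) (at t)" and dp1: "(p1 has_real_derivative p2 t) (at t)"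
    if "\<bar>t\<bar> < r / norm v" for t
  proof -
    show "(p has_real_derivative p1 t) (at t)"
      unfolding p_def p1_def
      by (rule has_real_derivative_Re_ray) (use h(1) in_ball[OF that] holomorphic_derivI in blast)
    have "((\<lambda>z. deriv h z * v) has_field_derivative deriv (deriv h) (of_real t * v) * v) (at (of_real t * v))"
      by (intro DERIV_cmult_right) (use h'(1) in_ball[OF that] holomorphic_derivI in blast)
    from has_real_derivative_Re_ray[OF this]
    show "(p1 has_real_derivative p2 t) (at t)"
      unfolding p2_def p1_def by simp
  qed
  have "isCont (deriv (deriv h)) 0"
    using h'(2) r by (meson centre_in_ball continuous_on_eq_continuous_at holomorphic_on_imp_continuous_on open_ball)
  then have "isCont p2 0"
    using isCont_o2[of "0::real" "\<lambda>t. complex_of_real t * v" "deriv (deriv h)"]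
    unfolding p2_def by (auto intro!: continuous_intros)
  moreover have "p2 0 = 1" using v2 by (simp add: p2_def H_def)
  ultimately have "(p2 \<longlongrightarrow> 1) (at 0)" by (simp add: isCont_def)
  then have "eventually (\<lambda>t. p2 t > 1/2) (at 0)"
    by (rule order_tendstoD(1)) simp
  then obtain \<delta> where \<delta>: "\<delta> > 0" "\<And>t. t \<noteq> 0 \<Longrightarrow> \<bar>t\<bar> < \<delta> \<Longrightarrow> p2 t > 1/2"
    unfolding eventually_at by auto
  define R where "R = min \<delta> (r / norm v) / 2"
  have R: "R > 0" "R < \<delta>" "R < r / norm v"
    using \<delta>(1) r vnz by (auto simp: R_def min_def divide_simps)
  have conv: "convex_on {-R..R} (\<lambda>t. p t - t\<^sup>2 / 4)"
  proof (rule f''_ge0_imp_convex)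
    fix x assume x: "x \<in> {-R..R}"
    then have x': "\<bar>x\<bar> < r / norm v" using R by auto
    show "((\<lambda>t. p t - t\<^sup>2 / 4) has_real_derivative p1 x - x / 2) (at x)"
      by (rule derivative_eq_intros dp[OF x'] refl | simp)+
    show "((\<lambda>x. p1 x - x / 2) has_real_derivative p2 x - 1 / 2) (at x)"
      by (rule derivative_eq_intros dp1[OF x'] refl | simp)+
    show "0 \<le> p2 x - 1 / 2"
    proof -
      have "\<bar>x\<bar> < \<delta>" using x R by auto
      then show ?thesis using \<delta>(2)[of x] \<open>p2 0 = 1\<close> by (cases "x = 0") auto
    qed
  qed auto
  have p0: "p 0 = 0"
    using norm0 h(2)[of 0] r by (simp add: p_def)
  have lnp: "norm (\<phi> (of_real t * v)) = exp (p t)" if "t \<in> {0..R}" for t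
    using h(2)[OF in_ball[of t]] that R by (simp add: p_def)
  have pos: "p t > 0" if t: "t \<in> {0<..R}" for t
  proof -
    have "((\<lambda>t. p t - t\<^sup>2 / 4) has_real_derivative p1 0 - 0 / 2) (at 0)"
      by (rule derivative_eq_intros dp refl | use R in simp)+
    then have "((\<lambda>t. p t - t\<^sup>2 / 4) has_real_derivative p1 0) (at 0 within {-R..R})"
      using has_field_derivative_at_within by fastforce
    then have "(p t - t\<^sup>2 / 4) - (p 0 - 0\<^sup>2 / 4) \<ge> p1 0 * (t - 0)"
      by (intro convex_on_imp_above_tangent[OF conv]) (use t R in auto)
    then have "p t \<ge> p1 0 * t + t\<^sup>2 / 4" using p0 by simp
    moreover have "p1 0 * t \<ge> 0" using slope t by (simp add: p1_def)
    moreover have "t\<^sup>2 / 4 > 0" using t by simp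
    ultimately show ?thesis by linarith
  qed
  show ?thesis
  proof (rule that[of R v])
    show "convex_on {0..R} (\<lambda>t. ln (norm (\<phi> (of_real t * v))) - t\<^sup>2 / 4)"
    proof -
      have "convex_on {0..R} (\<lambda>t. p t - t\<^sup>2 / 4)"
        using conv by (rule convex_on_subset) (use R in auto)
      then show ?thesis
        by (rule convex_on_eq) (simp add: lnp)
    qed
    show "\<forall>t\<in>{0..R}. \<phi> (of_real t * v) \<noteq> 0"
      using lnp by (metis exp_not_eq_zero norm_zero)
    show "\<forall>t\<in>{0<..R}. norm (\<phi> (of_real t * v)) > 1"
      using lnp pos by simp
  qed (use R vnz in auto)
qed

text \<open>
With \<open>\<phi> = exp \<circ> h\<close> near the origin, the derivative of \<open>ln \<bar>\<phi>\<bar> = Re h\<close> at the origin in the direction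
\<open>- cnj (h'(0))\<close> is \<open>- \<bar>h'(0)\<bar>\<^sup>2 < 0\<close>.
\<close>

lemma contracting_ray:
  fixes \<phi> :: "complex \<Rightarrow> complex"
  assumes hol: "\<phi> holomorphic_on UNIV" and norm0: "norm (\<phi> 0) = 1" and d: "deriv \<phi> 0 \<noteq> 0"
  obtains w r where "r > 0" "w \<noteq> 0" "\<forall>t\<in>{0<..<r}. norm (\<phi> (of_real t * w)) < 1"
proof -
  have nz: "\<phi> 0 \<noteq> 0" using norm0 by auto
  obtain R h where R: "R > 0" and h: "h holomorphic_on ball 0 R"
      "\<And>z. z \<in> ball 0 R \<Longrightarrow> \<phi> z = exp (h z)"
    and h1: "deriv h 0 = deriv \<phi> 0 / \<phi> 0"
    using local_logarithm[OF hol nz] by metis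
  define w where "w = - cnj (deriv h 0)"
  have wnz: "w \<noteq> 0" using d nz h1 by (simp add: w_def)
  have "(h has_field_derivative deriv h 0) (at (of_real 0 * w))"
    using h(1) R holomorphic_derivI[of h "ball 0 R" 0] by simp
  from has_real_derivative_Re_ray[OF this]
  have "((\<lambda>t. Re (h (of_real t * w))) has_real_derivative - (norm w)\<^sup>2) (at 0)"
    by (simp add: w_def complex_mult_cnj cmod_power2)
  then obtain \<delta> where \<delta>: "\<delta> > 0" "\<And>t. 0 < t \<Longrightarrow> t < \<delta> \<Longrightarrow> Re (h (of_real t * w)) < Re (h 0)"
    using DERIV_neg_dec_right[of "\<lambda>t. Re (h (of_real t * w))" "- (norm w)\<^sup>2" 0] wnz by auto
  have h0: "Re (h 0) = 0"
    using norm0 h(2)[of 0] R by simp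
  show ?thesis
  proof (rule that[of "min \<delta> (R / norm w)" w])
    show "\<forall>t\<in>{0<..<min \<delta> (R / norm w)}. norm (\<phi> (of_real t * w)) < 1"
      using \<delta>(2) h0 h(2) wnz
      by (auto simp: norm_mult pos_less_divide_eq)
  qed (use \<delta> R wnz in auto)
qed

text \<open>
A list with at most \<open>d\<close> entries is padded with zeros, where \<open>r\<close> vanishes, to a list of exactly \<open>d\<close>
points with equal weights \<open>1 / d\<close>.
\<close>

lemma jensen_with_zero:
  fixes ts :: "real list" and d :: nat and r :: "real \<Rightarrow> real"
  assumes conv: "convex_on {0..R} r" and r0: "r 0 = 0" and R: "0 \<le> R"
    and d: "d > 0" and len: "length ts \<le> d"
    and ts: "\<And>t. t \<in> set ts \<Longrightarrow> 0 \<le> t \<and> real d * t \<le> R"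
  shows "d * r (sum_list ts) \<le> (\<Sum>t\<leftarrow>ts. r (real d * t))"
proof -
  let ?y = "\<lambda>i. if i < length ts then real d * (ts ! i) else 0"
  have pad: "(\<Sum>i<d. if i < length ts then F i else 0) = (\<Sum>i<length ts. F i)" for F :: "nat \<Rightarrow> real"
    using len by (intro sum.mono_neutral_cong_right) auto
  have "r (\<Sum>i<d. (1/d) *\<^sub>R ?y i) \<le> (\<Sum>i<d. (1/d) * r (?y i))"
  proof (rule convex_on_sum[OF _ _ conv])
    fix i assume "i \<in> {..<d}"
    show "?y i \<in> {0..R}" using ts[OF nth_mem[of i ts]] R by auto
  qed (use d in \<open>auto simp: lessThan_empty_iff\<close>)
  also have "(\<Sum>i<d. (1/d) *\<^sub>R ?y i) = (\<Sum>i<d. if i < length ts then ts ! i else 0)"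
    using d by (intro sum.cong) auto
  also have "\<dots> = sum_list ts"
    by (simp add: pad sum_list_sum_nth atLeast0LessThan)
  also have "(\<Sum>i<d. (1/d) * r (?y i)) = (1/d) * (\<Sum>i<d. if i < length ts then r (real d * (ts ! i)) else 0)"
    unfolding sum_distrib_left by (intro sum.cong) (auto simp: r0)
  also have "\<dots> = (1/d) * (\<Sum>t\<leftarrow>ts. r (real d * t))"
    by (simp add: pad sum_list_sum_nth atLeast0LessThan)
  finally show ?thesis using d by (simp add: field_simps)
qed

lemma sum_list_pos_real:
  fixes ts :: "real list"
  assumes "ts \<noteq> []" "\<And>t. t \<in> set ts \<Longrightarrow> 0 < t"
  shows "0 < sum_list ts"
  using assms by (cases ts) (auto intro!: add_pos_nonneg sum_list_nonneg simp: less_imp_le)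

text \<open>
With \<open>s\<close> the sum of the entries and \<open>c = s / d\<close>, the difference of the two sides is
\<open>d \<Sum>(t - c)\<^sup>2 + (1 - length ts / d) s\<^sup>2\<close>; both terms are nonnegative, and they vanish together only
if there are \<open>d\<close> entries and all are equal to \<open>c\<close>.
\<close>

lemma strict_cauchy_schwarz:
  fixes ts :: "real list" and d :: nat
  assumes d: "d > 0" and len: "length ts \<le> d" and ne: "ts \<noteq> []"
    and pos: "\<And>t. t \<in> set ts \<Longrightarrow> 0 < t" and nconst: "\<And>t. ts \<noteq> replicate d t"
  shows "(sum_list ts)\<^sup>2 < d * (\<Sum>t\<leftarrow>ts. t\<^sup>2)"
proof -
  define s where "s = sum_list ts"
  define c where "c = s / d"
  have s: "s > 0"
    unfolding s_def using ne pos
    by (intro sum_list_pos_real) auto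
  have "(\<Sum>t\<leftarrow>ts. (t - c)\<^sup>2) = (\<Sum>t\<leftarrow>ts. t\<^sup>2) - 2 * c * s + length ts * c\<^sup>2"
    unfolding s_def by (induction ts) (auto simp: power2_eq_square algebra_simps)
  then have "d * (\<Sum>t\<leftarrow>ts. (t - c)\<^sup>2) = d * (\<Sum>t\<leftarrow>ts. t\<^sup>2) - 2 * s\<^sup>2 + (length ts / d) * s\<^sup>2"
    using d by (simp add: c_def field_simps power2_eq_square)
  then have eq: "d * (\<Sum>t\<leftarrow>ts. t\<^sup>2) - s\<^sup>2 = d * (\<Sum>t\<leftarrow>ts. (t - c)\<^sup>2) + (1 - length ts / d) * s\<^sup>2"
    by (simp add: algebra_simps)
  have nn: "(\<Sum>t\<leftarrow>ts. (t - c)\<^sup>2) \<ge> 0" by (intro sum_list_nonneg) auto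
  have "d * (\<Sum>t\<leftarrow>ts. (t - c)\<^sup>2) + (1 - length ts / d) * s\<^sup>2 > 0"
  proof (cases "length ts = d")
    case True
    then have "\<exists>t\<in>set ts. t \<noteq> c" using nconst[of c] replicate_eqI by metis
    then have "(\<Sum>t\<leftarrow>ts. (t - c)\<^sup>2) \<noteq> 0"
      by (subst sum_list_nonneg_eq_0_iff) auto
    then show ?thesis using nn d True by simp
  next
    case False
    then have "(1 - length ts / d) * s\<^sup>2 > 0" using len d s by simp
    then show ?thesis using nn by (simp add: add_nonneg_pos)
  qed
  then show ?thesis using eq by (simp add: s_def)
qed

section \<open>Domination of sums of exponents\<close>

lemma sum_list_ray: "(\<Sum>t\<leftarrow>ts. complex_of_real t * v) = of_real (sum_list ts) * v"
  by (induction ts) (auto simp: algebra_simps)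

lemma list_in_ray:
  assumes "\<And>\<mu>. \<mu> \<in> set xs \<Longrightarrow> \<exists>t. P t \<and> \<mu> = complex_of_real t * v"
  shows "\<exists>ts. xs = map (\<lambda>t. of_real t * v) ts \<and> (\<forall>t\<in>set ts. P t)"
proof -
  obtain f where f: "\<And>\<mu>. \<mu> \<in> set xs \<Longrightarrow> P (f \<mu>) \<and> \<mu> = complex_of_real (f \<mu>) * v"
    using assms by metis
  show ?thesis
    by (intro exI[of _ "map f xs"]) (use f in \<open>auto intro!: map_idI[symmetric]\<close>)
qed

lemma sum_list_scaled_le:
  fixes ts :: "real list" and R :: real
  assumes "\<And>t. t \<in> set ts \<Longrightarrow> real d * t \<le> R"
  shows "real d * sum_list ts \<le> length ts * R"
  using assms by (induction ts) (auto simp: algebra_simps add_mono)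

text \<open>
This is where convexity enters. Put \<open>p(t) = ln \<bar>\<phi>(t v)\<bar>\<close>. Jensen's inequality for \<open>p(t) - t\<^sup>2 / 4\<close>
together with the strict Cauchy-Schwarz inequality gives \<open>p(\<Sum>t) < (\<Sum>p(d t)) / d\<close>, unless the list
consists of \<open>d\<close> equal entries; the claim is the exponential of this inequality.
\<close>

lemma expanding_ray_product_less_one:
  fixes \<phi> :: "complex \<Rightarrow> complex" and d :: nat and xs :: "complex list"
  assumes R: "R > 0" and norm0: "norm (\<phi> 0) = 1"
    and nz: "\<And>t. t \<in> {0..R} \<Longrightarrow> \<phi> (of_real t * v) \<noteq> 0"
    and conv: "convex_on {0..R} (\<lambda>t. ln (norm (\<phi> (of_real t * v))) - t\<^sup>2 / 4)"
    and d: "d > 0" and ne: "xs \<noteq> []" and len: "length xs \<le> d"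
    and ray: "\<And>\<mu>. \<mu> \<in> set xs \<Longrightarrow> \<exists>t. (0 < t \<and> real d * t \<le> R) \<and> \<mu> = of_real t * v"
    and nconst: "\<And>\<mu>. xs \<noteq> replicate d \<mu>"
  shows "norm (\<phi> (sum_list xs)) * (\<Prod>\<mu>\<leftarrow>xs. norm (\<phi> (of_nat d * \<mu>)) powr (- 1 / d)) < 1"
proof -
  obtain ts where xs: "xs = map (\<lambda>t. of_real t * v) ts"
    and ts: "\<And>t. t \<in> set ts \<Longrightarrow> 0 < t \<and> real d * t \<le> R"
    using list_in_ray[of xs "\<lambda>t. 0 < t \<and> real d * t \<le> R" v, OF ray] by blast
  have ts_ne: "ts \<noteq> []" "length ts \<le> d"
    using ne len unfolding xs by simp_all
  have ts_nconst: "ts \<noteq> replicate d t" for t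
    using nconst[of "of_real t * v"] unfolding xs by (metis map_replicate)
  define p where "p t = ln (norm (\<phi> (of_real t * v)))" for t
  define s where "s = sum_list ts"
  have norm_p: "norm (\<phi> (of_real t * v)) = exp (p t)" if "t \<in> {0..R}" for t
    using nz[OF that] by (simp add: p_def)
  have "s > 0" unfolding s_def by (rule sum_list_pos_real) (use ts_ne(1) ts in auto)
  have "real d * s \<le> length ts * R"
    unfolding s_def by (rule sum_list_scaled_le) (use ts in auto)
  also have "\<dots> \<le> d * R" using ts_ne(2) R by simp
  finally have sR: "s \<in> {0..R}" using d \<open>s > 0\<close> by simp
  have prod: "(\<Prod>\<mu>\<leftarrow>map (\<lambda>t. of_real t * v) us. norm (\<phi> (of_nat d * \<mu>)) powr (- 1 / d))
      = exp (- (\<Sum>t\<leftarrow>us. p (real d * t)) / d)"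
    if "\<And>t. t \<in> set us \<Longrightarrow> 0 < t \<and> real d * t \<le> R" for us
    using that
  proof (induction us)
    case (Cons t us)
    have "norm (\<phi> (of_nat d * (of_real t * v))) = exp (p (real d * t))"
      using norm_p[of "real d * t"] Cons.prems[of t] by (simp add: mult.assoc less_imp_le)
    then have "norm (\<phi> (of_nat d * (of_real t * v))) powr (- 1 / d) = exp (- p (real d * t) / d)"
      by (simp only: exp_powr_real) simp
    then show ?case
      using Cons by (simp add: exp_add[symmetric] add_divide_distrib diff_divide_distrib)
  qed simp
  have "d * (p s - s\<^sup>2 / 4) \<le> (\<Sum>t\<leftarrow>ts. p (real d * t) - (real d * t)\<^sup>2 / 4)"
    unfolding p_def s_def
  proof (rule jensen_with_zero[OF conv _ _ d ts_ne(2)])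
    show "0 \<le> t \<and> real d * t \<le> R" if "t \<in> set ts" for t
      using ts[OF that] by simp
  qed (use norm0 R in simp_all)
  also have "\<dots> = (\<Sum>t\<leftarrow>ts. p (real d * t)) - d * (d * (\<Sum>t\<leftarrow>ts. t\<^sup>2)) / 4"
    by (induction ts) (auto simp: power2_eq_square algebra_simps add_divide_distrib)
  finally have "d * p s \<le> (\<Sum>t\<leftarrow>ts. p (real d * t)) - d * (d * (\<Sum>t\<leftarrow>ts. t\<^sup>2) - s\<^sup>2) / 4"
    by (simp add: algebra_simps diff_divide_distrib)
  moreover have "s\<^sup>2 < d * (\<Sum>t\<leftarrow>ts. t\<^sup>2)"
    unfolding s_def by (rule strict_cauchy_schwarz[OF d ts_ne(2,1) _ ts_nconst]) (use ts in auto)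
  then have "d * (d * (\<Sum>t\<leftarrow>ts. t\<^sup>2) - s\<^sup>2) > 0"
    using d by simp
  ultimately have "d * p s < (\<Sum>t\<leftarrow>ts. p (real d * t))" by linarith
  then have "p s - (\<Sum>t\<leftarrow>ts. p (real d * t)) / d < 0"
    using d by (simp add: field_simps)
  then have "exp (p s) * exp (- (\<Sum>t\<leftarrow>ts. p (real d * t)) / d) < 1"
    by (simp flip: exp_add)
  then show ?thesis
    using norm_p[OF sR] prod[OF ts] unfolding xs sum_list_ray s_def by simp
qed

lemma zero_islimpt_ray:
  assumes "v \<noteq> 0" "\<eta> > 0" "{of_real t * v |t. 0 < t \<and> t < \<eta>} \<subseteq> S"
  shows "(0::complex) islimpt S"
proof -
  have "0 islimpt {of_real t * v |t. 0 < t \<and> t < \<eta>}"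
    unfolding islimpt_approachable
  proof safe
    fix e :: real assume "e > 0"
    define t where "t = min (\<eta> / 2) (e / (2 * norm v))"
    have "0 < t" "t < \<eta>" using assms \<open>e > 0\<close> by (auto simp: t_def)
    moreover have "t \<le> e / (2 * norm v)" by (simp add: t_def)
    then have "t * norm v < e" using assms \<open>e > 0\<close> by (simp add: field_simps)
    ultimately show "\<exists>x'\<in>{of_real t * v |t. 0 < t \<and> t < \<eta>}. x' \<noteq> 0 \<and> dist x' 0 < e"
      using assms by (intro bexI[of _ "of_real t * v"]) (auto simp: norm_mult)
  qed
  then show ?thesis using assms(3) islimpt_subset by blast
qed

text \<open>
The coefficient of \<open>E \<mu>\<close>, for \<open>\<mu> \<in> \<Lambda>\<close>, will be chosen proportional to the \<open>n\<close>-th power of a \<open>d\<close>-th root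
of \<open>1 / \<phi>(d \<mu>)\<close>, so that in a product of \<open>d\<close> such terms the iterate \<open>T\<^sup>n\<close> exactly cancels the
decay. The weight is the modulus of that root; exponents outside \<open>\<Lambda>\<close> carry constant coefficients.
\<close>

definition growth_weight :: "(complex \<Rightarrow> complex) \<Rightarrow> nat \<Rightarrow> complex set \<Rightarrow> complex \<Rightarrow> real" where
  "growth_weight \<phi> d \<Lambda> \<mu> = (if \<mu> \<in> \<Lambda> then norm (\<phi> (of_nat d * \<mu>)) powr (- 1 / d) else 1)"

text \<open>
After the application of \<open>T\<^sup>n\<close>, the product of the terms with exponents \<open>xs\<close> has a coefficient whose
modulus is, up to a constant, the \<open>n\<close>-th power of the quantity below. Exponents taken from the
contracting ray alone give a sum on that ray, where \<open>\<bar>\<phi>\<bar> < 1\<close>; exponents taken from \<open>\<Lambda>\<close> alone are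
covered by convexity. A mixed list contains fewer than \<open>d\<close> exponents from the finite set \<open>\<Lambda>\<close>, so the strict inequality for those persists under
the small perturbation coming from \<open>\<Gamma>\<close>. This is why \<open>\<Gamma>\<close> is only chosen once \<open>\<Lambda>\<close> is known.
\<close>

proposition dominated_exponents:
  fixes \<phi> :: "complex \<Rightarrow> complex" and d :: nat
  assumes hol: "\<phi> holomorphic_on UNIV" and norm0: "norm (\<phi> 0) = 1"
    and curv: "deriv (deriv \<phi>) 0 * \<phi> 0 \<noteq> (deriv \<phi> 0)\<^sup>2" and slope: "deriv \<phi> 0 \<noteq> 0"
    and d: "d > 0"
  obtains U where "0 islimpt U" "\<forall>\<mu>\<in>U. norm (\<phi> \<mu>) > 1"
    "\<forall>\<Lambda>. finite \<Lambda> \<and> (\<forall>\<mu>\<in>\<Lambda>. of_nat d * \<mu> \<in> U) \<longrightarrow>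
       (\<exists>\<Gamma>. 0 islimpt \<Gamma> \<and> \<Gamma> \<inter> \<Lambda> = {} \<and>
         (\<forall>xs. xs \<noteq> [] \<and> length xs \<le> d \<and> set xs \<subseteq> \<Gamma> \<union> \<Lambda> \<and> (\<forall>\<mu>\<in>\<Lambda>. xs \<noteq> replicate d \<mu>) \<longrightarrow>
            norm (\<phi> (sum_list xs)) * (\<Prod>\<mu>\<leftarrow>xs. growth_weight \<phi> d \<Lambda> \<mu>) < 1))"
proof -
  obtain R v where R: "R > 0" "v \<noteq> 0" and nz: "\<forall>t\<in>{0..R}. \<phi> (of_real t * v) \<noteq> 0"
    and big: "\<forall>t\<in>{0<..R}. norm (\<phi> (of_real t * v)) > 1"
    and conv: "convex_on {0..R} (\<lambda>t. ln (norm (\<phi> (of_real t * v))) - t\<^sup>2 / 4)"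
    by (rule expanding_strictly_convex_ray[OF hol norm0 curv])
  obtain w r where r: "r > 0" "w \<noteq> 0" and small: "\<forall>t\<in>{0<..<r}. norm (\<phi> (of_real t * w)) < 1"
    using contracting_ray[OF hol norm0 slope] by blast
  define U where "U = {of_real t * v |t. 0 < t \<and> t \<le> R}"
  have "\<exists>\<Gamma>. 0 islimpt \<Gamma> \<and> \<Gamma> \<inter> \<Lambda> = {} \<and>
         (\<forall>xs. xs \<noteq> [] \<and> length xs \<le> d \<and> set xs \<subseteq> \<Gamma> \<union> \<Lambda> \<and> (\<forall>\<mu>\<in>\<Lambda>. xs \<noteq> replicate d \<mu>) \<longrightarrow>
            norm (\<phi> (sum_list xs)) * (\<Prod>\<mu>\<leftarrow>xs. growth_weight \<phi> d \<Lambda> \<mu>) < 1)"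
    if fin: "finite \<Lambda>" and \<Lambda>: "\<forall>\<mu>\<in>\<Lambda>. of_nat d * \<mu> \<in> U" for \<Lambda>
  proof -
    have ray: "\<exists>t. (0 < t \<and> real d * t \<le> R) \<and> \<mu> = of_real t * v" if "\<mu> \<in> \<Lambda>" for \<mu>
    proof -
      have "of_nat d * \<mu> \<in> U" using \<Lambda> that by blast
      then obtain t where t: "of_nat d * \<mu> = of_real t * v" "0 < t" "t \<le> R"
        unfolding U_def by blast
      have "of_real (t / d) * v = (of_real t * v) / of_nat d" by simp
      also have "\<dots> = \<mu>" unfolding t(1)[symmetric] using d by simp
      finally show ?thesis using d t(2,3) by (intro exI[of _ "t / d"]) simp
    qed
    have weight: "(\<Prod>\<mu>\<leftarrow>ls. growth_weight \<phi> d \<Lambda> \<mu>) = (\<Prod>\<mu>\<leftarrow>ls. norm (\<phi> (of_nat d * \<mu>)) powr (- 1 / d))"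
      if "set ls \<subseteq> \<Lambda>" for ls
      using that by (intro arg_cong[where f=prod_list] map_cong) (auto simp: growth_weight_def)
    have only_\<Lambda>: "norm (\<phi> (sum_list ls)) * (\<Prod>\<mu>\<leftarrow>ls. growth_weight \<phi> d \<Lambda> \<mu>) < 1"
      if "set ls \<subseteq> \<Lambda>" "ls \<noteq> []" "length ls \<le> d" "\<And>\<mu>. ls \<noteq> replicate d \<mu>" for ls
      unfolding weight[OF that(1)]
    proof (rule expanding_ray_product_less_one[OF R(1) norm0 _ conv d])
      show "\<exists>t. (0 < t \<and> real d * t \<le> R) \<and> \<mu> = of_real t * v" if "\<mu> \<in> set ls" for \<mu>
        using ray[of \<mu>] that \<open>set ls \<subseteq> \<Lambda>\<close> by auto
    qed (use that nz in auto)
    define F where "F = {ls. set ls \<subseteq> \<Lambda> \<and> length ls < d} - {[]}"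
    have "finite F"
      unfolding F_def using finite_lists_length_le[OF fin, of d]
      by (auto elim!: finite_subset[rotated])
    moreover have "eventually (\<lambda>z. norm (\<phi> (z + sum_list ls)) * (\<Prod>\<mu>\<leftarrow>ls. growth_weight \<phi> d \<Lambda> \<mu>) < 1) (nhds 0)"
      if "ls \<in> F" for ls
    proof -
      have "isCont \<phi> (sum_list ls)"
        using hol holomorphic_on_imp_continuous_on continuous_on_eq_continuous_at open_UNIV by blast
      then have "isCont (\<lambda>z. norm (\<phi> (z + sum_list ls)) * (\<Prod>\<mu>\<leftarrow>ls. growth_weight \<phi> d \<Lambda> \<mu>)) 0"
        (is "isCont ?G 0")
        by (intro continuous_intros isCont_o2[of 0 "\<lambda>z. z + sum_list ls" \<phi>]) auto
      then have "(?G \<longlongrightarrow> ?G 0) (nhds 0)"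
        unfolding isCont_def using tendsto_at_iff_tendsto_nhds[of ?G 0] by blast
      moreover have "?G 0 < 1"
      proof -
        have "ls \<noteq> replicate d \<mu>" for \<mu> using that by (auto simp: F_def)
        then show ?thesis using only_\<Lambda>[of ls] that by (simp add: F_def)
      qed
      ultimately show ?thesis
        by (rule order_tendstoD(2))
    qed
    ultimately have "eventually (\<lambda>z. \<forall>ls\<in>F. norm (\<phi> (z + sum_list ls)) * (\<Prod>\<mu>\<leftarrow>ls. growth_weight \<phi> d \<Lambda> \<mu>) < 1) (nhds 0)"
      by (simp add: eventually_ball_finite)
    moreover have "eventually (\<lambda>z. z \<notin> \<Lambda>) (nhds 0)"
    proof -
      have "0 \<notin> \<Lambda>" using ray[of 0] R(2) by auto
      then show ?thesis
        using eventually_nhds_in_open[of "- \<Lambda>" 0] finite_imp_closed[OF fin] by (simp add: open_Compl)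
    qed
    ultimately have "eventually (\<lambda>z. z \<notin> \<Lambda> \<and> (\<forall>ls\<in>F. norm (\<phi> (z + sum_list ls)) *
        (\<Prod>\<mu>\<leftarrow>ls. growth_weight \<phi> d \<Lambda> \<mu>) < 1)) (nhds 0)"
      by eventually_elim blast
    then obtain \<delta> where \<delta>: "\<delta> > 0" and \<delta>\<Lambda>: "\<And>z. norm z < \<delta> \<Longrightarrow> z \<notin> \<Lambda>"
      and mixed: "\<And>z ls. norm z < \<delta> \<Longrightarrow> ls \<in> F \<Longrightarrow>
            norm (\<phi> (z + sum_list ls)) * (\<Prod>\<mu>\<leftarrow>ls. growth_weight \<phi> d \<Lambda> \<mu>) < 1"
      unfolding eventually_nhds_metric dist_0_norm dist_commute[of _ "0::complex"] by metis
    define \<eta> where "\<eta> = min r (\<delta> / norm w)"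
    have \<eta>: "\<eta> > 0" using r \<delta> by (simp add: \<eta>_def)
    have \<eta>_small: "norm (of_real s * w) < \<delta>" if "0 \<le> s" "s < \<eta>" for s
      using that r(2) by (auto simp: \<eta>_def norm_mult pos_less_divide_eq)
    define \<Gamma> where "\<Gamma> = {of_real t * w |t. 0 < t \<and> t < \<eta> / d}"
    have disj: "\<Gamma> \<inter> \<Lambda> = {}"
    proof -
      have "norm z < \<delta>" if z: "z \<in> \<Gamma>" for z
      proof -
        obtain t where t: "z = of_real t * w" "0 < t" "t < \<eta> / d" using z \<Gamma>_def by blast
        moreover have "\<eta> / d \<le> \<eta> / 1" using d \<eta> by (intro divide_left_mono) auto
        ultimately show ?thesis using \<eta>_small[of t] by simp
      qed
      then show ?thesis using \<delta>\<Lambda> by blast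
    qed
    have "norm (\<phi> (sum_list xs)) * (\<Prod>\<mu>\<leftarrow>xs. growth_weight \<phi> d \<Lambda> \<mu>) < 1"
      if xs: "xs \<noteq> []" "length xs \<le> d" "set xs \<subseteq> \<Gamma> \<union> \<Lambda>" "\<forall>\<mu>\<in>\<Lambda>. xs \<noteq> replicate d \<mu>" for xs
    proof -
      define gs where "gs = filter (\<lambda>\<mu>. \<mu> \<notin> \<Lambda>) xs"
      define ls where "ls = filter (\<lambda>\<mu>. \<mu> \<in> \<Lambda>) xs"
      have sum: "sum_list xs = sum_list gs + sum_list ls"
        unfolding gs_def ls_def by (induction xs) auto
      have prod: "(\<Prod>\<mu>\<leftarrow>xs. growth_weight \<phi> d \<Lambda> \<mu>) = (\<Prod>\<mu>\<leftarrow>ls. growth_weight \<phi> d \<Lambda> \<mu>)"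
        unfolding ls_def by (induction xs) (auto simp: growth_weight_def)
      have len: "length gs + length ls = length xs"
        unfolding gs_def ls_def by (metis add.commute sum_length_filter_compl)
      have ls: "set ls \<subseteq> \<Lambda>" by (auto simp: ls_def)
      have "\<exists>t. (0 < t \<and> t < \<eta> / d) \<and> \<mu> = of_real t * w" if "\<mu> \<in> set gs" for \<mu>
        using that xs(3) by (auto simp: gs_def \<Gamma>_def)
      from list_in_ray[of gs "\<lambda>t. 0 < t \<and> t < \<eta> / d" w, OF this] obtain ts where gs: "gs = map (\<lambda>t. of_real t * w) ts"
        and ts: "\<And>t. t \<in> set ts \<Longrightarrow> 0 < t \<and> t < \<eta> / d"
        by blast
      show ?thesis
      proof (cases "gs = []")
        case True
        then have "xs = ls"
          unfolding gs_def ls_def by (metis (mono_tags, lifting) filter_empty_conv filter_True)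
        moreover have "ls \<noteq> replicate d \<mu>" for \<mu>
          using xs(4) ls \<open>xs = ls\<close> d by (cases "\<mu> \<in> \<Lambda>") auto
        ultimately show ?thesis using only_\<Lambda>[OF ls] xs(1,2) by blast
      next
        case False
        define s where "s = sum_list ts"
        have "ts \<noteq> []" using False gs by simp
        then have s0: "s > 0" unfolding s_def by (rule sum_list_pos_real) (use ts in auto)
        have "real d * s < d * \<eta>"
        proof -
          have "sum_list ts < (\<Sum>t\<leftarrow>ts. \<eta> / d)"
            using \<open>ts \<noteq> []\<close> ts by (induction ts rule: list_nonempty_induct) (auto intro: add_strict_mono)
          also have "\<dots> = length ts * (\<eta> / d)" by (simp add: sum_list_triv)
          also have "\<dots> \<le> d * (\<eta> / d)"
            using len xs(2) gs \<eta> by (intro mult_right_mono) auto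
          finally show ?thesis using d by (simp add: s_def)
        qed
        then have s\<eta>: "s < \<eta>" using d by simp
        have sum_gs: "sum_list gs = of_real s * w" by (simp add: gs sum_list_ray s_def)
        show ?thesis
        proof (cases "ls = []")
          case True
          then show ?thesis
            using small s0 s\<eta> by (simp add: prod sum sum_gs \<eta>_def)
        next
          case ls_ne: False
          have "length ls < d" using len False xs(2) by (cases gs) auto
          then have "ls \<in> F" using ls ls_ne by (simp add: F_def)
          then show ?thesis
            using mixed[OF \<eta>_small[of s]] s0 s\<eta> by (simp add: prod sum sum_gs)
        qed
      qed
    qed
    moreover have "0 islimpt \<Gamma>"
      by (rule zero_islimpt_ray[of w "\<eta> / d"]) (use r \<eta> d in \<open>auto simp: \<Gamma>_def\<close>)
    ultimately show ?thesis using disj by blast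
  qed
  moreover have "0 islimpt U"
    by (rule zero_islimpt_ray[of v R]) (use R in \<open>auto simp: U_def intro: less_imp_le\<close>)
  moreover have "\<forall>\<mu>\<in>U. norm (\<phi> \<mu>) > 1"
    using big unfolding U_def by auto
  ultimately show ?thesis using that[of U] by simp
qed

section \<open>Orbits of monomials in eigenvectors\<close>

abbreviation lists_over :: "'b set \<Rightarrow> nat \<Rightarrow> 'b list set" where
  "lists_over M n \<equiv> {xs. set xs \<subseteq> M \<and> length xs = n}"

lemma sum_lists_Suc:
  "(\<Sum>xs\<in>lists_over M (Suc n). F xs) = (\<Sum>\<mu>\<in>M. \<Sum>xs\<in>lists_over M n. F (\<mu> # xs))"
proof -
  have "lists_over M (Suc n) = (\<lambda>(\<mu>, xs). \<mu> # xs) ` (M \<times> lists_over M n)"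
    by (auto simp: length_Suc_conv)
  moreover have "inj_on (\<lambda>(\<mu>, xs). \<mu> # xs) (M \<times> lists_over M n)"
    by (auto simp: inj_on_def)
  ultimately show ?thesis
    by (simp add: sum.reindex sum.cartesian_product case_prod_unfold)
qed

lemma tendsto_fun_componentwise:
  fixes f :: "'c \<Rightarrow> 'i \<Rightarrow> 'b :: topological_space"
  assumes "\<And>i. ((\<lambda>x. f x i) \<longlongrightarrow> l i) F"
  shows "(f \<longlongrightarrow> l) F"
proof -
  have "limitin (product_topology (\<lambda>_. euclidean) UNIV) f l F"
    unfolding limitin_componentwise using assms by simp
  then show ?thesis by (simp add: euclidean_product_topology)
qed

text \<open>
A power of a dense set is dense in the product topology.
\<close>

lemma dense_functions_meet_open:
  fixes W :: "('i \<Rightarrow> 'b :: topological_space) set"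
  assumes "open W" "W \<noteq> {}" "closure D = UNIV"
  obtains A where "A \<in> W" "\<forall>i. A i \<in> D"
proof -
  have "closure (PiE UNIV (\<lambda>_::'i. D)) = UNIV"
    using closure_of_product_topology[of "\<lambda>_::'i. euclidean" UNIV "\<lambda>_. D"] assms(3)
    by (simp add: euclidean_product_topology)
  then have "W \<inter> PiE UNIV (\<lambda>_. D) \<noteq> {}"
    using open_Int_closure_eq_empty[OF assms(1)] assms(2) by auto
  then show ?thesis using that by auto
qed

lemma prod_list_mult_power:
  fixes \<tau> a :: "'i \<Rightarrow> 'j \<Rightarrow> complex"
  shows "(\<Prod>(i, \<mu>)\<leftarrow>zs. a i \<mu> * \<tau> i \<mu> ^ n) = (\<Prod>(i, \<mu>)\<leftarrow>zs. a i \<mu>) * (\<Prod>(i, \<mu>)\<leftarrow>zs. \<tau> i \<mu>) ^ n"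
proof (induction zs)
  case (Cons z zs)
  obtain i \<mu> where "z = (i, \<mu>)" by (cases z)
  with Cons show ?case by (simp add: power_mult_distrib)
qed simp

text \<open>
Multiply the vectors \<open>smul (\<tau> i \<mu> ^ n) (E \<mu>)\<close>, with \<open>i\<close> and \<open>\<mu>\<close> running in parallel through the word
\<open>w\<close> and the list \<open>xs\<close>, and apply \<open>T\<^sup>n\<close>: the coefficient of the resulting eigenvector is the \<open>n\<close>-th
power of this number.
\<close>

definition growth_factor ::
    "(complex \<Rightarrow> complex) \<Rightarrow> (nat \<Rightarrow> complex \<Rightarrow> complex) \<Rightarrow> nat list \<Rightarrow> complex list \<Rightarrow> complex" where
  "growth_factor \<phi> \<tau> w xs = (\<Prod>(i, \<mu>)\<leftarrow>zip w xs. \<tau> i \<mu>) * \<phi> (sum_list xs)"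

context F_space
begin

lemma tendsto_vec_add:
  fixes f g :: "'b \<Rightarrow> 'a"
  assumes "(f \<longlongrightarrow> a) F" "(g \<longlongrightarrow> b) F"
  shows "((\<lambda>x. f x + g x) \<longlongrightarrow> a + b) F"
  using continuous_on_tendsto_compose[OF continuous_add tendsto_Pair[OF assms]] by simp

lemma tendsto_smul:
  assumes "(c \<longlongrightarrow> a) F" "(g \<longlongrightarrow> b) F"
  shows "((\<lambda>x. smul (c x) (g x)) \<longlongrightarrow> smul a b) F"
  using continuous_on_tendsto_compose[OF continuous_smul tendsto_Pair[OF assms]] by simp

lemma tendsto_vec_sum:
  fixes f :: "'c \<Rightarrow> 'b \<Rightarrow> 'a"
  assumes "\<And>i. i \<in> I \<Longrightarrow> (f i \<longlongrightarrow> a i) F"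
  shows "((\<lambda>x. \<Sum>i\<in>I. f i x) \<longlongrightarrow> (\<Sum>i\<in>I. a i)) F"
  using assms by (induction I rule: infinite_finite_induct) (auto intro: tendsto_vec_add)

lemma span_image_sum:
  assumes "x \<in> module.span smul (E ` U)"
  obtains F b where "finite F" "F \<subseteq> U" "x = (\<Sum>\<mu>\<in>F. smul (b \<mu>) (E \<mu>))"
proof -
  obtain t r where t: "finite t" "t \<subseteq> E ` U" "x = (\<Sum>a\<in>t. smul (r a) a)"
    using assms unfolding span_explicit by blast
  then obtain F where F: "F \<subseteq> U" "inj_on E F" "t = E ` F"
    using t(2) unfolding subset_image_inj by blast
  show ?thesis
  proof (rule that)
    show "finite F" using F t finite_imageD by blast
    show "x = (\<Sum>\<mu>\<in>F. smul (r (E \<mu>)) (E \<mu>))" using F t by (simp add: sum.reindex)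
  qed (use F in auto)
qed

end

context commutative_F_algebra
begin

lemma smul_mult_smul: "smul a x * smul b y = smul (a * b) (x * y)"
proof -
  have "x * smul b y = smul b (x * y)"
    using smul_mult_left[of b y x] by (simp add: mult.commute)
  then show ?thesis
    using smul_mult_left[of a x "smul b y"] by simp
qed

lemma continuous_on_monomial:
  "continuous_on UNIV (\<lambda>f :: nat \<Rightarrow> 'a. prod_nonempty (map f w))"
proof (induction w rule: induct_list012)
  case (3 i j w)
  have "continuous_on UNIV (\<lambda>f :: nat \<Rightarrow> 'a. (f i, prod_nonempty (map f (j # w))))"
    using 3(2) by (intro continuous_intros continuous_on_product_coordinates) simp
  then show ?case
    using continuous_on_compose2[OF continuous_mult] by fastforce
qed auto

end

text \<open>
A monomial in the entries of a sequence \<open>f\<close> is encoded by a nonempty word \<open>w\<close> of indices, its value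
being \<open>prod_nonempty (map f w)\<close>. Since \<open>E\<close> turns sums into products, the product of linear
combinations of values of \<open>E\<close> is again such a combination, and \<open>T\<close> acts diagonally on it.
\<close>

locale exponential_eigenvectors = commutative_F_algebra smul
  for smul :: "complex \<Rightarrow> 'a \<Rightarrow> 'a :: {comm_ring, topological_space}" +
  fixes T :: "'a \<Rightarrow> 'a" and E :: "complex \<Rightarrow> 'a" and \<phi> :: "complex \<Rightarrow> complex"
  assumes operator: "continuous_operator smul T"
    and eigen: "T (E z) = smul (\<phi> z) (E z)"
    and exponential: "E z * E w = E (z + w)"
begin

lemma linear_iterate: "module_hom smul smul (T ^^ n)"
proof (induction n)
  case 0
  then show ?case by (simp add: module_hom_iff module_axioms)
next
  case (Suc n)
  have "module_hom smul smul T"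
    using operator by (simp add: continuous_operator_def module_hom_iff_linear)
  with Suc show ?case by (simp add: module_hom_iff)
qed

lemma continuous_iterate: "continuous_on UNIV (T ^^ n)"
proof (induction n)
  case (Suc n)
  moreover have "continuous_on UNIV T"
    using operator by (simp add: continuous_operator_def)
  ultimately show ?case
    by (simp add: continuous_on_compose2 o_def)
qed (simp add: continuous_on_id id_def)

lemma iterate_eigen: "(T ^^ n) (smul c (E z)) = smul (c * \<phi> z ^ n) (E z)"
proof (induction n)
  case (Suc n)
  have "T (smul b (E z)) = smul b (T (E z))" for b
    using linear_iterate[of 1] by (simp add: module_hom_iff)
  with Suc show ?case by (simp add: eigen mult_ac)
qed simp

lemma monomial_of_sums:
  assumes "w \<noteq> []"
  shows "prod_nonempty (map (\<lambda>i. \<Sum>\<mu>\<in>M. smul (c i \<mu>) (E \<mu>)) w) =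
    (\<Sum>xs\<in>lists_over M (length w). smul (\<Prod>(i, \<mu>)\<leftarrow>zip w xs. c i \<mu>) (E (sum_list xs)))"
  using assms
proof (induction w rule: list_nonempty_induct)
  case (single i)
  have "{xs. xs = [] \<and> set xs \<subseteq> M} = {[]}" by auto
  then show ?case by (simp add: sum_lists_Suc)
next
  case (cons i w)
  obtain j w' where w: "w = j # w'" using cons.hyps by (cases w) auto
  have "prod_nonempty (map (\<lambda>i. \<Sum>\<mu>\<in>M. smul (c i \<mu>) (E \<mu>)) (i # w)) =
      (\<Sum>\<mu>\<in>M. smul (c i \<mu>) (E \<mu>)) *
      (\<Sum>xs\<in>lists_over M (length w). smul (\<Prod>(i, \<mu>)\<leftarrow>zip w xs. c i \<mu>) (E (sum_list xs)))"
    unfolding cons.IH[symmetric] by (simp add: w)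
  also have "\<dots> = (\<Sum>\<mu>\<in>M. \<Sum>xs\<in>lists_over M (length w).
      smul (c i \<mu> * (\<Prod>(i, \<mu>)\<leftarrow>zip w xs. c i \<mu>)) (E (\<mu> + sum_list xs)))"
    by (simp only: sum_product smul_mult_smul exponential)
  also have "\<dots> = (\<Sum>xs\<in>lists_over M (length (i # w)).
      smul (\<Prod>(i, \<mu>)\<leftarrow>zip (i # w) xs. c i \<mu>) (E (sum_list xs)))"
    unfolding length_Cons sum_lists_Suc by simp
  finally show ?case .
qed

lemma orbit_of_monomial:
  assumes "w \<noteq> []"
  shows "(T ^^ n) (prod_nonempty (map (\<lambda>i. \<Sum>\<mu>\<in>M. smul (a i \<mu> * \<tau> i \<mu> ^ n) (E \<mu>)) w)) =
    (\<Sum>xs\<in>lists_over M (length w).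
       smul ((\<Prod>(i, \<mu>)\<leftarrow>zip w xs. a i \<mu>) * growth_factor \<phi> \<tau> w xs ^ n) (E (sum_list xs)))"
proof -
  have "(\<Prod>(i, \<mu>)\<leftarrow>zs. a i \<mu> * \<tau> i \<mu> ^ n) * \<phi> z ^ n =
      (\<Prod>(i, \<mu>)\<leftarrow>zs. a i \<mu>) * ((\<Prod>(i, \<mu>)\<leftarrow>zs. \<tau> i \<mu>) * \<phi> z) ^ n" for zs z
    by (simp only: prod_list_mult_power power_mult_distrib mult.assoc)
  then show ?thesis
    unfolding monomial_of_sums[OF assms] module_hom.sum[OF linear_iterate] iterate_eigen growth_factor_def
    by (simp only:)
qed

lemma limit_of_orbit:
  assumes "\<And>xs. xs \<in> lists_over M k \<Longrightarrow> norm (q xs) < 1 \<or> q xs = 1"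
  shows "(\<lambda>n. \<Sum>xs\<in>lists_over M k. smul (b xs * q xs ^ n) (E (sum_list xs)))
    \<longlonglongrightarrow> (\<Sum>xs\<in>lists_over M k. smul (if q xs = 1 then b xs else 0) (E (sum_list xs)))"
proof -
  have "(\<lambda>n. b xs * q xs ^ n) \<longlonglongrightarrow> (if q xs = 1 then b xs else 0)" if "xs \<in> lists_over M k" for xs
    using assms[OF that]
  proof
    assume "norm (q xs) < 1"
    moreover from this have "q xs \<noteq> 1" by auto
    ultimately show ?thesis
      using tendsto_mult_right_zero[OF LIMSEQ_power_zero[of "q xs"]] by simp
  qed simp
  then show ?thesis
    by (intro tendsto_vec_sum tendsto_smul tendsto_const)
qed

end

section \<open>Growth rates adapted to a dominating word\<close>

lemma tendsto_prod_list:
  fixes f :: "'b \<Rightarrow> 'c \<Rightarrow> complex"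
  assumes "\<And>z. (f z \<longlongrightarrow> l z) F"
  shows "((\<lambda>x. \<Prod>z\<leftarrow>zs. f z x) \<longlongrightarrow> (\<Prod>z\<leftarrow>zs. l z)) F"
  by (induction zs) (auto intro!: tendsto_mult assms)

lemma complex_root_exists:
  assumes "d > 0"
  shows "\<exists>h :: complex. h ^ d = b"
proof (cases "b = 0")
  case False
  have "exp (Ln b / of_nat d) ^ d = b"
    using assms False by (simp add: exp_of_nat_mult[symmetric])
  then show ?thesis by blast
qed (use assms in auto)

text \<open>
The word \<open>w\<close> plays the role of the leading monomial: it has maximal degree, and among the words of the
same degree it is exposed by a linear functional of the exponent vector, given by the weights \<open>l\<close>.
\<close>

definition dominates :: "nat list \<Rightarrow> nat list set \<Rightarrow> bool" where
  "dominates w S \<longleftrightarrow> w \<noteq> [] \<and> finite S \<and>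
     (\<exists>l :: nat \<Rightarrow> real. \<forall>v\<in>S. v \<noteq> [] \<and>
        (length v < length w \<or> length v = length w \<and> (\<Sum>i\<leftarrow>v. l i) < (\<Sum>i\<leftarrow>w. l i)))"

text \<open>
The factors \<open>exp (\<epsilon> c i)\<close> give the \<open>i\<close>-th entry of the sequence its own exponential scale. They separate
monomials of equal degree from each other, while for small \<open>\<epsilon>\<close> they do not disturb the finitely many
strict inequalities that hold at \<open>\<epsilon> = 0\<close>.
\<close>

definition tilted_rate ::
    "complex set \<Rightarrow> (complex \<Rightarrow> complex) \<Rightarrow> (nat \<Rightarrow> real) \<Rightarrow> real \<Rightarrow> nat \<Rightarrow> complex \<Rightarrow> complex" where
  "tilted_rate \<Lambda> \<kappa> c \<epsilon> i \<mu> = (if \<mu> \<in> \<Lambda> then of_real (exp (\<epsilon> * c i)) * \<kappa> \<mu> else 1)"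

lemma tendsto_tilted_rate:
  "((\<lambda>\<epsilon>. tilted_rate \<Lambda> \<kappa> c \<epsilon> i \<mu>) \<longlongrightarrow> tilted_rate \<Lambda> \<kappa> c 0 i \<mu>) (at_right 0)"
  unfolding tilted_rate_def by (auto intro!: tendsto_eq_intros)

lemma growth_factor_tilted_less_one:
  assumes \<kappa>: "\<And>\<mu>. \<mu> \<in> \<Lambda> \<Longrightarrow> norm (\<kappa> \<mu>) = growth_weight \<phi> d \<Lambda> \<mu>"
    and len: "length v = length xs"
    and small: "norm (\<phi> (sum_list xs)) * (\<Prod>\<mu>\<leftarrow>xs. growth_weight \<phi> d \<Lambda> \<mu>) < 1"
  shows "\<forall>\<^sub>F \<epsilon> in at_right 0. norm (growth_factor \<phi> (tilted_rate \<Lambda> \<kappa> c \<epsilon>) v xs) < 1"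
proof -
  have "norm (\<Prod>(i, \<mu>)\<leftarrow>zip v xs. tilted_rate \<Lambda> \<kappa> c 0 i \<mu>) = (\<Prod>\<mu>\<leftarrow>xs. growth_weight \<phi> d \<Lambda> \<mu>)"
    using len
    by (induction v xs rule: list_induct2) (auto simp: norm_mult tilted_rate_def \<kappa> growth_weight_def)
  then have "norm (growth_factor \<phi> (tilted_rate \<Lambda> \<kappa> c 0) v xs) < 1"
    using small by (simp add: growth_factor_def norm_mult mult.commute)
  moreover have "((\<lambda>\<epsilon>. growth_factor \<phi> (tilted_rate \<Lambda> \<kappa> c \<epsilon>) v xs)
      \<longlongrightarrow> growth_factor \<phi> (tilted_rate \<Lambda> \<kappa> c 0) v xs) (at_right 0)"
    unfolding growth_factor_def case_prod_unfold
    by (intro tendsto_mult tendsto_const tendsto_prod_list tendsto_tilted_rate)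
  ultimately show ?thesis
    using order_tendstoD(2)[OF tendsto_norm] by blast
qed

lemma growth_factor_tilted_constant:
  assumes "\<mu> \<in> \<Lambda>" "length v = d" and \<kappa>: "\<kappa> \<mu> ^ d = inverse (\<phi> (of_nat d * \<mu>))"
    and nz: "\<phi> (of_nat d * \<mu>) \<noteq> 0"
  shows "growth_factor \<phi> (tilted_rate \<Lambda> \<kappa> c \<epsilon>) v (replicate d \<mu>) = of_real (exp (\<epsilon> * (\<Sum>i\<leftarrow>v. c i)))"
proof -
  have "(\<Prod>(i, \<mu>)\<leftarrow>zip v (replicate (length v) \<mu>). tilted_rate \<Lambda> \<kappa> c \<epsilon> i \<mu>) =
      of_real (exp (\<epsilon> * (\<Sum>i\<leftarrow>v. c i))) * \<kappa> \<mu> ^ length v"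
    using assms(1) by (induction v) (auto simp: tilted_rate_def algebra_simps exp_add)
  then show ?thesis
    using assms(2) \<kappa> nz by (auto simp: growth_factor_def sum_list_replicate)
qed

text \<open>
The weights of \<open>dominates\<close> are normalised to \<open>c i = l i - m\<close> with mean zero along \<open>w\<close>. For a list \<open>xs\<close>
that is not made of \<open>d\<close> copies of one \<open>\<mu> \<in> \<Lambda>\<close>, the growth factor is smaller than one in modulus at
\<open>\<epsilon> = 0\<close>, hence for small \<open>\<epsilon>\<close>. For \<open>d\<close> copies of \<open>\<mu>\<close> the growth factor along a word \<open>v\<close> is
\<open>exp (\<epsilon> \<Sum>c)\<close>: it equals one for \<open>v = w\<close>, and it is smaller than one for the words of length \<open>d\<close>
in \<open>S\<close>, because the functional is strictly smaller on them.
\<close>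

proposition exists_growth_rates:
  fixes \<phi> :: "complex \<Rightarrow> complex" and \<Gamma> \<Lambda> :: "complex set"
  assumes dom: "dominates w S" and d: "d = length w"
    and fin: "finite \<Gamma>" "finite \<Lambda>" and disj: "\<Gamma> \<inter> \<Lambda> = {}" and finL: "finite L"
    and big: "\<And>\<mu>. \<mu> \<in> \<Lambda> \<Longrightarrow> norm (\<phi> (of_nat d * \<mu>)) > 1"
    and small: "\<And>xs. xs \<noteq> [] \<Longrightarrow> length xs \<le> d \<Longrightarrow> set xs \<subseteq> \<Gamma> \<union> \<Lambda> \<Longrightarrow> \<forall>\<mu>\<in>\<Lambda>. xs \<noteq> replicate d \<mu>
        \<Longrightarrow> norm (\<phi> (sum_list xs)) * (\<Prod>\<mu>\<leftarrow>xs. growth_weight \<phi> d \<Lambda> \<mu>) < 1"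
  shows "\<exists>\<tau>. (\<forall>i. \<forall>\<mu>\<in>\<Gamma>. \<tau> i \<mu> = 1) \<and> (\<forall>i\<in>L. \<forall>\<mu>\<in>\<Lambda>. norm (\<tau> i \<mu>) < 1) \<and>
    (\<forall>v\<in>S. \<forall>xs\<in>lists_over (\<Gamma> \<union> \<Lambda>) (length v). norm (growth_factor \<phi> \<tau> v xs) < 1) \<and>
    (\<forall>xs\<in>lists_over (\<Gamma> \<union> \<Lambda>) d. if \<exists>\<mu>\<in>\<Lambda>. xs = replicate d \<mu>
       then growth_factor \<phi> \<tau> w xs = 1 else norm (growth_factor \<phi> \<tau> w xs) < 1)"
proof -
  have d0: "d > 0" and finS: "finite S" using dom d by (auto simp: dominates_def)
  obtain l :: "nat \<Rightarrow> real" where l: "\<forall>v\<in>S. v \<noteq> [] \<and>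
        (length v < length w \<or> length v = length w \<and> (\<Sum>i\<leftarrow>v. l i) < (\<Sum>i\<leftarrow>w. l i))"
    using dom unfolding dominates_def by blast
  define m where "m = (\<Sum>i\<leftarrow>w. l i) / d"
  define c where "c i = l i - m" for i
  have c_sum: "(\<Sum>i\<leftarrow>v. c i) = (\<Sum>i\<leftarrow>v. l i) - length v * m" for v
    unfolding c_def by (induction v) (auto simp: algebra_simps)
  have c_w: "(\<Sum>i\<leftarrow>w. c i) = 0" using d0 d by (simp add: c_sum m_def)
  have "\<exists>\<kappa>. \<forall>\<mu>. \<kappa> \<mu> ^ d = inverse (\<phi> (of_nat d * \<mu>))"
    by (intro choice allI complex_root_exists d0)
  then obtain \<kappa> where \<kappa>: "\<And>\<mu>. \<kappa> \<mu> ^ d = inverse (\<phi> (of_nat d * \<mu>))" by blast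
  have norm_\<kappa>: "norm (\<kappa> \<mu>) = growth_weight \<phi> d \<Lambda> \<mu>" if "\<mu> \<in> \<Lambda>" for \<mu>
  proof -
    have pos: "norm (\<phi> (of_nat d * \<mu>)) > 0" using big[OF that] by linarith
    have "norm (\<kappa> \<mu>) ^ d = inverse (norm (\<phi> (of_nat d * \<mu>)))"
      by (simp add: \<kappa> norm_inverse flip: norm_power)
    also have "\<dots> = norm (\<phi> (of_nat d * \<mu>)) powr (- 1 / d * d)"
      using pos d0 by (simp add: powr_minus)
    also have "\<dots> = (norm (\<phi> (of_nat d * \<mu>)) powr (- 1 / d)) powr d"
      by (rule powr_powr[symmetric])
    also have "\<dots> = (norm (\<phi> (of_nat d * \<mu>)) powr (- 1 / d)) ^ d"
      using pos by (intro powr_realpow) simp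
    finally show ?thesis
      using that d0 by (auto simp: growth_weight_def intro: power_eq_imp_eq_base)
  qed
  let ?\<tau> = "tilted_rate \<Lambda> \<kappa> c"
  have 1: "\<forall>\<^sub>F \<epsilon> in at_right 0. \<forall>i\<in>L. \<forall>\<mu>\<in>\<Lambda>. norm (?\<tau> \<epsilon> i \<mu>) < 1"
  proof (intro eventually_ball_finite ballI finL fin)
    fix i \<mu> assume \<mu>: "\<mu> \<in> \<Lambda>"
    have "norm (\<phi> (of_nat d * \<mu>)) powr (- 1 / d) < norm (\<phi> (of_nat d * \<mu>)) powr 0"
      using big[OF \<mu>] d0 by (intro powr_less_mono) auto
    then have "norm (?\<tau> 0 i \<mu>) < 1"
      using \<mu> norm_\<kappa>[OF \<mu>] big[OF \<mu>] by (simp add: tilted_rate_def growth_weight_def split: if_splits)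
    then show "\<forall>\<^sub>F \<epsilon> in at_right 0. norm (?\<tau> \<epsilon> i \<mu>) < 1"
      using order_tendstoD(2)[OF tendsto_norm[OF tendsto_tilted_rate]] by blast
  qed
  have nonconst: "\<forall>\<^sub>F \<epsilon> in at_right 0. norm (growth_factor \<phi> (?\<tau> \<epsilon>) v xs) < 1"
    if "v \<noteq> []" "length v \<le> d" "xs \<in> lists_over (\<Gamma> \<union> \<Lambda>) (length v)" "\<forall>\<mu>\<in>\<Lambda>. xs \<noteq> replicate d \<mu>" for v xs
    using that by (intro growth_factor_tilted_less_one[where d = d] norm_\<kappa> small) auto
  have const: "growth_factor \<phi> (?\<tau> \<epsilon>) v (replicate d \<mu>) = of_real (exp (\<epsilon> * (\<Sum>i\<leftarrow>v. c i)))"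
    if "\<mu> \<in> \<Lambda>" "length v = d" for \<epsilon> \<mu> v
  proof -
    have "\<phi> (of_nat d * \<mu>) \<noteq> 0" using big[OF that(1)] by auto
    then show ?thesis using that \<kappa> by (intro growth_factor_tilted_constant) auto
  qed
  have fin_lists: "finite (lists_over (\<Gamma> \<union> \<Lambda>) k)" for k
    using fin by (intro finite_lists_length_eq) auto
  have 2: "\<forall>\<^sub>F \<epsilon> in at_right 0. \<forall>v\<in>S. \<forall>xs\<in>lists_over (\<Gamma> \<union> \<Lambda>) (length v). norm (growth_factor \<phi> (?\<tau> \<epsilon>) v xs) < 1"
  proof (intro eventually_ball_finite ballI finS fin_lists)
    fix v xs assume v: "v \<in> S" and xs: "xs \<in> lists_over (\<Gamma> \<union> \<Lambda>) (length v)"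
    have v': "v \<noteq> []" "length v \<le> d" using l v d by auto
    show "\<forall>\<^sub>F \<epsilon> in at_right 0. norm (growth_factor \<phi> (?\<tau> \<epsilon>) v xs) < 1"
    proof (cases "\<exists>\<mu>\<in>\<Lambda>. xs = replicate d \<mu>")
      case True
      then obtain \<mu> where \<mu>: "\<mu> \<in> \<Lambda>" "xs = replicate d \<mu>" by blast
      have len: "length v = d" using xs \<mu>(2) by simp
      then have "(\<Sum>i\<leftarrow>v. l i) < (\<Sum>i\<leftarrow>w. l i)" using l v d by auto
      then have "(\<Sum>i\<leftarrow>v. c i) < 0" using c_w len d by (simp add: c_sum)
      then have "norm (growth_factor \<phi> (?\<tau> \<epsilon>) v xs) < 1" if "\<epsilon> > 0" for \<epsilon>
        using that unfolding \<mu>(2) const[OF \<mu>(1) len] by (simp add: mult_pos_neg)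
      then show ?thesis
        by (intro eventually_at_rightI[of 0 1]) auto
    next
      case False
      then show ?thesis using nonconst[OF v' xs] by blast
    qed
  qed
  have 3: "\<forall>\<^sub>F \<epsilon> in at_right 0. \<forall>xs\<in>lists_over (\<Gamma> \<union> \<Lambda>) d.
      (if \<exists>\<mu>\<in>\<Lambda>. xs = replicate d \<mu> then growth_factor \<phi> (?\<tau> \<epsilon>) w xs = 1
       else norm (growth_factor \<phi> (?\<tau> \<epsilon>) w xs) < 1)"
  proof (intro eventually_ball_finite ballI fin_lists)
    fix xs assume xs: "xs \<in> lists_over (\<Gamma> \<union> \<Lambda>) d"
    show "\<forall>\<^sub>F \<epsilon> in at_right 0. if \<exists>\<mu>\<in>\<Lambda>. xs = replicate d \<mu> then growth_factor \<phi> (?\<tau> \<epsilon>) w xs = 1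
       else norm (growth_factor \<phi> (?\<tau> \<epsilon>) w xs) < 1"
    proof (cases "\<exists>\<mu>\<in>\<Lambda>. xs = replicate d \<mu>")
      case True
      then have "growth_factor \<phi> (?\<tau> \<epsilon>) w xs = 1" for \<epsilon>
        using const[of _ w \<epsilon>] d c_w by auto
      then show ?thesis using True by simp
    next
      case False
      have "\<forall>\<^sub>F \<epsilon> in at_right 0. norm (growth_factor \<phi> (?\<tau> \<epsilon>) w xs) < 1"
        using False xs d d0 by (intro nonconst) auto
      then show ?thesis using False by simp
    qed
  qed
  obtain \<epsilon> where "\<forall>i\<in>L. \<forall>\<mu>\<in>\<Lambda>. norm (?\<tau> \<epsilon> i \<mu>) < 1"
    "\<forall>v\<in>S. \<forall>xs\<in>lists_over (\<Gamma> \<union> \<Lambda>) (length v). norm (growth_factor \<phi> (?\<tau> \<epsilon>) v xs) < 1"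
    "\<forall>xs\<in>lists_over (\<Gamma> \<union> \<Lambda>) d.
      (if \<exists>\<mu>\<in>\<Lambda>. xs = replicate d \<mu> then growth_factor \<phi> (?\<tau> \<epsilon>) w xs = 1
       else norm (growth_factor \<phi> (?\<tau> \<epsilon>) w xs) < 1)"
    using eventually_happens'[OF _ eventually_conj[OF 1 eventually_conj[OF 2 3]]] by auto
  moreover have "\<forall>i. \<forall>\<mu>\<in>\<Gamma>. ?\<tau> \<epsilon> i \<mu> = 1"
    using disj by (auto simp: tilted_rate_def)
  ultimately show ?thesis by (intro exI[of _ "?\<tau> \<epsilon>"]) simp
qed

section \<open>Steering all monomials simultaneously\<close>

lemma prod_zip_replicate_const:
  assumes "\<And>i. c i \<mu> = (h :: complex)"
  shows "(\<Prod>(i, \<nu>)\<leftarrow>zip v (replicate (length v) \<mu>). c i \<nu>) = h ^ length v"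
  using assms by (induction v) auto

context exponential_eigenvectors
begin

text \<open>
The density statement behind the Baire category argument. Choose \<open>A \<in> W\<close> with entries spanned by
eigenvectors with exponents in \<open>\<Gamma>\<close>, a target \<open>g = \<Sum>b(d \<mu>) E(d \<mu>)\<close> in \<open>V\<close>, and perturb the finitely
many relevant entries of \<open>A\<close> by \<open>\<Sum>h(\<mu>) \<tau>\<^sub>i(\<mu>)\<^sup>n E(\<mu>)\<close> with \<open>h(\<mu>)\<^sup>d = b(d \<mu>)\<close>. The perturbation tends
to zero. After the expansion of a monomial and the application of \<open>T\<^sup>n\<close>, the only terms that do not tend
to zero come from \<open>w\<close> and \<open>d\<close> equal exponents \<open>\<mu>\<close>; they are \<open>b(d \<mu>) E(d \<mu>)\<close> and add up to \<open>g\<close>.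
\<close>

proposition simultaneous_orbits:
  fixes W :: "(nat \<Rightarrow> 'a) set"
  assumes hol: "\<phi> holomorphic_on UNIV" and norm0: "norm (\<phi> 0) = 1"
    and curv: "deriv (deriv \<phi>) 0 * \<phi> 0 \<noteq> (deriv \<phi> 0)\<^sup>2" and slope: "deriv \<phi> 0 \<noteq> 0"
    and dense: "\<And>U. 0 islimpt U \<Longrightarrow> closure (span (E ` U)) = UNIV"
    and dom: "dominates w S"
    and V: "open V" "V \<noteq> {}" and Z: "open Z" "0 \<in> Z" and W: "open W" "W \<noteq> {}"
  shows "\<exists>f\<in>W. \<exists>n. (T ^^ n) (prod_nonempty (map f w)) \<in> V \<and> (\<forall>v\<in>S. (T ^^ n) (prod_nonempty (map f v)) \<in> Z)"
proof -
  define d where "d = length w"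
  have d0: "d > 0" and finS: "finite S" and ne: "w \<noteq> []" "\<And>v. v \<in> S \<Longrightarrow> v \<noteq> []"
    using dom by (auto simp: d_def dominates_def)
  obtain U where U: "0 islimpt U" and big: "\<forall>\<mu>\<in>U. norm (\<phi> \<mu>) > 1"
    and dominated: "\<forall>\<Lambda>. finite \<Lambda> \<and> (\<forall>\<mu>\<in>\<Lambda>. of_nat d * \<mu> \<in> U) \<longrightarrow>
       (\<exists>\<Gamma>. 0 islimpt \<Gamma> \<and> \<Gamma> \<inter> \<Lambda> = {} \<and>
         (\<forall>xs. xs \<noteq> [] \<and> length xs \<le> d \<and> set xs \<subseteq> \<Gamma> \<union> \<Lambda> \<and> (\<forall>\<mu>\<in>\<Lambda>. xs \<noteq> replicate d \<mu>) \<longrightarrow>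
            norm (\<phi> (sum_list xs)) * (\<Prod>\<mu>\<leftarrow>xs. growth_weight \<phi> d \<Lambda> \<mu>) < 1))"
    by (rule dominated_exponents[OF hol norm0 curv slope d0])
  have "V \<inter> span (E ` U) \<noteq> {}"
    using open_Int_closure_eq_empty[OF V(1), of "span (E ` U)"] V(2) dense[OF U] by auto
  then obtain g where g: "g \<in> V" "g \<in> span (E ` U)" by blast
  obtain F b where F: "finite F" "F \<subseteq> U" "g = (\<Sum>\<mu>\<in>F. smul (b \<mu>) (E \<mu>))"
    by (rule span_image_sum[OF g(2)])
  \<comment> \<open>exponents whose \<open>d\<close>-fold multiples are the exponents of the target\<close>
  define \<Lambda> where "\<Lambda> = (\<lambda>\<mu>. \<mu> / of_nat d) ` F"
  have fin\<Lambda>: "finite \<Lambda>" using F(1) by (simp add: \<Lambda>_def)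
  have \<Lambda>U: "\<forall>\<mu>\<in>\<Lambda>. of_nat d * \<mu> \<in> U" using F(2) d0 by (auto simp: \<Lambda>_def)
  have g_sum: "g = (\<Sum>\<mu>\<in>\<Lambda>. smul (b (of_nat d * \<mu>)) (E (of_nat d * \<mu>)))"
  proof -
    have "inj_on (\<lambda>\<mu>. \<mu> / of_nat d :: complex) F" using d0 by (auto simp: inj_on_def)
    then show ?thesis using d0 by (simp add: F(3) \<Lambda>_def sum.reindex)
  qed
  have "\<exists>\<Gamma>. 0 islimpt \<Gamma> \<and> \<Gamma> \<inter> \<Lambda> = {} \<and>
         (\<forall>xs. xs \<noteq> [] \<and> length xs \<le> d \<and> set xs \<subseteq> \<Gamma> \<union> \<Lambda> \<and> (\<forall>\<mu>\<in>\<Lambda>. xs \<noteq> replicate d \<mu>) \<longrightarrow>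
            norm (\<phi> (sum_list xs)) * (\<Prod>\<mu>\<leftarrow>xs. growth_weight \<phi> d \<Lambda> \<mu>) < 1)"
    by (rule mp[OF spec[OF dominated] conjI[OF fin\<Lambda> \<Lambda>U]])
  then obtain \<Gamma>0 where \<Gamma>0: "0 islimpt \<Gamma>0" "\<Gamma>0 \<inter> \<Lambda> = {}"
    and small: "\<forall>xs. xs \<noteq> [] \<and> length xs \<le> d \<and> set xs \<subseteq> \<Gamma>0 \<union> \<Lambda> \<and> (\<forall>\<mu>\<in>\<Lambda>. xs \<noteq> replicate d \<mu>) \<longrightarrow>
            norm (\<phi> (sum_list xs)) * (\<Prod>\<mu>\<leftarrow>xs. growth_weight \<phi> d \<Lambda> \<mu>) < 1"
    by (elim exE conjE)
  obtain A where A: "A \<in> W" "\<forall>i. A i \<in> span (E ` \<Gamma>0)"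
    by (rule dense_functions_meet_open[OF W dense[OF \<Gamma>0(1)]])
  have "\<forall>i. \<exists>G a. finite G \<and> G \<subseteq> \<Gamma>0 \<and> A i = (\<Sum>\<mu>\<in>G. smul (a \<mu>) (E \<mu>))"
  proof
    fix i
    obtain G a where "finite G" "G \<subseteq> \<Gamma>0" "A i = (\<Sum>\<mu>\<in>G. smul (a \<mu>) (E \<mu>))"
      by (rule span_image_sum[OF spec[OF A(2)]])
    then show "\<exists>G a. finite G \<and> G \<subseteq> \<Gamma>0 \<and> A i = (\<Sum>\<mu>\<in>G. smul (a \<mu>) (E \<mu>))" by blast
  qed
  from choice[OF this] obtain G where
    "\<forall>i. \<exists>a. finite (G i) \<and> G i \<subseteq> \<Gamma>0 \<and> A i = (\<Sum>\<mu>\<in>G i. smul (a \<mu>) (E \<mu>))" by blast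
  from choice[OF this] obtain a where
    Ga: "\<forall>i. finite (G i) \<and> G i \<subseteq> \<Gamma>0 \<and> A i = (\<Sum>\<mu>\<in>G i. smul (a i \<mu>) (E \<mu>))" by blast
  define L where "L = set w \<union> (\<Union>v\<in>S. set v)"
  have finL: "finite L" using finS by (simp add: L_def)
  define \<Gamma> where "\<Gamma> = (\<Union>i\<in>L. G i)"
  have fin\<Gamma>: "finite \<Gamma>" and \<Gamma>_sub: "\<Gamma> \<subseteq> \<Gamma>0" and disj: "\<Gamma> \<inter> \<Lambda> = {}"
    using Ga finL \<Gamma>0(2) by (auto simp: \<Gamma>_def)
  have "\<exists>\<tau>. (\<forall>i. \<forall>\<mu>\<in>\<Gamma>. \<tau> i \<mu> = 1) \<and> (\<forall>i\<in>L. \<forall>\<mu>\<in>\<Lambda>. norm (\<tau> i \<mu>) < 1) \<and>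
    (\<forall>v\<in>S. \<forall>xs\<in>lists_over (\<Gamma> \<union> \<Lambda>) (length v). norm (growth_factor \<phi> \<tau> v xs) < 1) \<and>
    (\<forall>xs\<in>lists_over (\<Gamma> \<union> \<Lambda>) d. if \<exists>\<mu>\<in>\<Lambda>. xs = replicate d \<mu>
       then growth_factor \<phi> \<tau> w xs = 1 else norm (growth_factor \<phi> \<tau> w xs) < 1)"
  proof (rule exists_growth_rates[OF dom d_def fin\<Gamma> fin\<Lambda> disj finL])
    fix xs assume "xs \<noteq> []" "length xs \<le> d" "set xs \<subseteq> \<Gamma> \<union> \<Lambda>" "\<forall>\<mu>\<in>\<Lambda>. xs \<noteq> replicate d \<mu>"
    moreover from this have "set xs \<subseteq> \<Gamma>0 \<union> \<Lambda>" using \<Gamma>_sub by blast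
    ultimately show "norm (\<phi> (sum_list xs)) * (\<Prod>\<mu>\<leftarrow>xs. growth_weight \<phi> d \<Lambda> \<mu>) < 1"
      using small by simp
  qed (use big \<Lambda>U in simp)
  then obtain \<tau> where \<tau>\<Gamma>: "\<forall>i. \<forall>\<mu>\<in>\<Gamma>. \<tau> i \<mu> = 1" and \<tau>\<Lambda>: "\<forall>i\<in>L. \<forall>\<mu>\<in>\<Lambda>. norm (\<tau> i \<mu>) < 1"
    and \<tau>S: "\<forall>v\<in>S. \<forall>xs\<in>lists_over (\<Gamma> \<union> \<Lambda>) (length v). norm (growth_factor \<phi> \<tau> v xs) < 1"
    and \<tau>w: "\<forall>xs\<in>lists_over (\<Gamma> \<union> \<Lambda>) d. if \<exists>\<mu>\<in>\<Lambda>. xs = replicate d \<mu>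
       then growth_factor \<phi> \<tau> w xs = 1 else norm (growth_factor \<phi> \<tau> w xs) < 1"
    by blast
  have "\<exists>h. \<forall>\<mu>. h \<mu> ^ d = b (of_nat d * \<mu>)"
    by (intro choice allI complex_root_exists d0)
  then obtain h where h: "\<And>\<mu>. h \<mu> ^ d = b (of_nat d * \<mu>)" by blast
  \<comment> \<open>the values for \<open>\<mu> \<in> G i\<close> reproduce \<open>A i\<close>; those for \<open>\<mu> \<in> \<Lambda>\<close> produce the target\<close>
  define coef where "coef i \<mu> = (if \<mu> \<in> \<Lambda> then h \<mu> else if \<mu> \<in> G i then a i \<mu> else 0)" for i \<mu>
  define x where "x n i = (\<Sum>\<mu>\<in>\<Gamma> \<union> \<Lambda>. smul (coef i \<mu> * \<tau> i \<mu> ^ n) (E \<mu>))" for n i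
  define f where "f n i = (if i \<in> L then x n i else A i)" for n i
  have "(\<lambda>n. f n i) \<longlonglongrightarrow> A i" for i
  proof (cases "i \<in> L")
    case True
    have "(\<lambda>n. coef i \<mu> * \<tau> i \<mu> ^ n) \<longlonglongrightarrow> (if \<mu> \<in> G i then a i \<mu> else 0)" if \<mu>: "\<mu> \<in> \<Gamma> \<union> \<Lambda>" for \<mu>
    proof (cases "\<mu> \<in> \<Lambda>")
      case \<mu>\<Lambda>: True
      then have "\<mu> \<notin> G i" using Ga \<Gamma>0(2) by blast
      moreover have "norm (\<tau> i \<mu>) < 1" using \<tau>\<Lambda> True \<mu>\<Lambda> by blast
      ultimately show ?thesis
        using tendsto_mult_right_zero[OF LIMSEQ_power_zero[of "\<tau> i \<mu>"]] by simp
    next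
      case False
      then show ?thesis using \<mu> \<tau>\<Gamma> by (simp add: coef_def)
    qed
    then have "(\<lambda>n. x n i) \<longlonglongrightarrow> (\<Sum>\<mu>\<in>\<Gamma> \<union> \<Lambda>. smul (if \<mu> \<in> G i then a i \<mu> else 0) (E \<mu>))"
      unfolding x_def by (intro tendsto_vec_sum tendsto_smul tendsto_const)
    also have "(\<Sum>\<mu>\<in>\<Gamma> \<union> \<Lambda>. smul (if \<mu> \<in> G i then a i \<mu> else 0) (E \<mu>)) = A i"
    proof -
      have "G i \<subseteq> \<Gamma> \<union> \<Lambda>" using True by (auto simp: \<Gamma>_def)
      then have "(\<Sum>\<mu>\<in>\<Gamma> \<union> \<Lambda>. smul (if \<mu> \<in> G i then a i \<mu> else 0) (E \<mu>)) = (\<Sum>\<mu>\<in>G i. smul (a i \<mu>) (E \<mu>))"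
        using fin\<Gamma> fin\<Lambda> by (intro sum.mono_neutral_cong_right) auto
      then show ?thesis using Ga by simp
    qed
    finally show ?thesis using True by (simp add: f_def)
  qed (simp add: f_def)
  then have "f \<longlonglongrightarrow> A" by (rule tendsto_fun_componentwise)
  then have ev_W: "\<forall>\<^sub>F n in sequentially. f n \<in> W"
    using W(1) A(1) by (rule topological_tendstoD)
  have orbit: "(T ^^ n) (prod_nonempty (map (f n) v)) = (\<Sum>xs\<in>lists_over (\<Gamma> \<union> \<Lambda>) (length v).
      smul ((\<Prod>(i, \<mu>)\<leftarrow>zip v xs. coef i \<mu>) * growth_factor \<phi> \<tau> v xs ^ n) (E (sum_list xs)))"
    if "v \<noteq> []" "set v \<subseteq> L" for v n
  proof -
    have "map (f n) v = map (\<lambda>i. \<Sum>\<mu>\<in>\<Gamma> \<union> \<Lambda>. smul (coef i \<mu> * \<tau> i \<mu> ^ n) (E \<mu>)) v"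
      using that(2) by (auto simp: f_def x_def)
    then show ?thesis by (simp only: orbit_of_monomial[OF that(1)])
  qed
  have ev_S: "\<forall>\<^sub>F n in sequentially. \<forall>v\<in>S. (T ^^ n) (prod_nonempty (map (f n) v)) \<in> Z"
  proof (intro eventually_ball_finite[OF finS] ballI)
    fix v assume v: "v \<in> S"
    have q: "norm (growth_factor \<phi> \<tau> v xs) < 1" if "xs \<in> lists_over (\<Gamma> \<union> \<Lambda>) (length v)" for xs
      using \<tau>S v that by blast
    have "(\<lambda>n. \<Sum>xs\<in>lists_over (\<Gamma> \<union> \<Lambda>) (length v).
        smul ((\<Prod>(i, \<mu>)\<leftarrow>zip v xs. coef i \<mu>) * growth_factor \<phi> \<tau> v xs ^ n) (E (sum_list xs)))
      \<longlonglongrightarrow> (\<Sum>xs\<in>lists_over (\<Gamma> \<union> \<Lambda>) (length v).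
        smul (if growth_factor \<phi> \<tau> v xs = 1 then (\<Prod>(i, \<mu>)\<leftarrow>zip v xs. coef i \<mu>) else 0) (E (sum_list xs)))"
      by (rule limit_of_orbit) (use q in blast)
    also have "(\<Sum>xs\<in>lists_over (\<Gamma> \<union> \<Lambda>) (length v).
        smul (if growth_factor \<phi> \<tau> v xs = 1 then (\<Prod>(i, \<mu>)\<leftarrow>zip v xs. coef i \<mu>) else 0) (E (sum_list xs))) = 0"
    proof (intro sum.neutral ballI)
      fix xs assume "xs \<in> lists_over (\<Gamma> \<union> \<Lambda>) (length v)"
      then have "growth_factor \<phi> \<tau> v xs \<noteq> 1" using q[of xs] by auto
      then show "smul (if growth_factor \<phi> \<tau> v xs = 1 then (\<Prod>(i, \<mu>)\<leftarrow>zip v xs. coef i \<mu>) else 0) (E (sum_list xs)) = 0"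
        by simp
    qed
    finally have "(\<lambda>n. (T ^^ n) (prod_nonempty (map (f n) v))) \<longlonglongrightarrow> 0"
      using orbit[OF ne(2)[OF v]] v by (simp add: L_def UN_upper le_supI2)
    then show "\<forall>\<^sub>F n in sequentially. (T ^^ n) (prod_nonempty (map (f n) v)) \<in> Z"
      using Z by (rule topological_tendstoD)
  qed
  have ev_V: "\<forall>\<^sub>F n in sequentially. (T ^^ n) (prod_nonempty (map (f n) w)) \<in> V"
  proof -
    have "(\<lambda>n. \<Sum>xs\<in>lists_over (\<Gamma> \<union> \<Lambda>) d.
        smul ((\<Prod>(i, \<mu>)\<leftarrow>zip w xs. coef i \<mu>) * growth_factor \<phi> \<tau> w xs ^ n) (E (sum_list xs)))
      \<longlonglongrightarrow> (\<Sum>xs\<in>lists_over (\<Gamma> \<union> \<Lambda>) d.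
        smul (if growth_factor \<phi> \<tau> w xs = 1 then (\<Prod>(i, \<mu>)\<leftarrow>zip w xs. coef i \<mu>) else 0) (E (sum_list xs)))"
    proof (rule limit_of_orbit)
      show "norm (growth_factor \<phi> \<tau> w xs) < 1 \<or> growth_factor \<phi> \<tau> w xs = 1"
        if "xs \<in> lists_over (\<Gamma> \<union> \<Lambda>) d" for xs
        using bspec[OF \<tau>w that] by (simp split: if_splits)
    qed
    also have "(\<Sum>xs\<in>lists_over (\<Gamma> \<union> \<Lambda>) d.
        smul (if growth_factor \<phi> \<tau> w xs = 1 then (\<Prod>(i, \<mu>)\<leftarrow>zip w xs. coef i \<mu>) else 0) (E (sum_list xs)))
      = (\<Sum>xs\<in>replicate d ` \<Lambda>. smul (\<Prod>(i, \<mu>)\<leftarrow>zip w xs. coef i \<mu>) (E (sum_list xs)))"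
    proof (rule sum.mono_neutral_cong_right)
      show "finite (lists_over (\<Gamma> \<union> \<Lambda>) d)" using fin\<Gamma> fin\<Lambda> by (intro finite_lists_length_eq) auto
      show sub: "replicate d ` \<Lambda> \<subseteq> lists_over (\<Gamma> \<union> \<Lambda>) d" by auto
      show "\<forall>xs\<in>lists_over (\<Gamma> \<union> \<Lambda>) d - replicate d ` \<Lambda>.
          smul (if growth_factor \<phi> \<tau> w xs = 1 then (\<Prod>(i, \<mu>)\<leftarrow>zip w xs. coef i \<mu>) else 0) (E (sum_list xs)) = 0"
      proof
        fix xs assume xs: "xs \<in> lists_over (\<Gamma> \<union> \<Lambda>) d - replicate d ` \<Lambda>"
        then have "\<not> (\<exists>\<mu>\<in>\<Lambda>. xs = replicate d \<mu>)" by auto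
        then have "norm (growth_factor \<phi> \<tau> w xs) < 1" using bspec[OF \<tau>w, of xs] xs by simp
        then have "growth_factor \<phi> \<tau> w xs \<noteq> 1" by auto
        then show "smul (if growth_factor \<phi> \<tau> w xs = 1 then (\<Prod>(i, \<mu>)\<leftarrow>zip w xs. coef i \<mu>) else 0) (E (sum_list xs)) = 0"
          by simp
      qed
      fix xs assume xs: "xs \<in> replicate d ` \<Lambda>"
      then have "\<exists>\<mu>\<in>\<Lambda>. xs = replicate d \<mu>" by blast
      moreover have "xs \<in> lists_over (\<Gamma> \<union> \<Lambda>) d" using xs sub by blast
      ultimately have "growth_factor \<phi> \<tau> w xs = 1"
        using bspec[OF \<tau>w, of xs] by simp
      then show "smul (if growth_factor \<phi> \<tau> w xs = 1 then (\<Prod>(i, \<mu>)\<leftarrow>zip w xs. coef i \<mu>) else 0) (E (sum_list xs))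
         = smul (\<Prod>(i, \<mu>)\<leftarrow>zip w xs. coef i \<mu>) (E (sum_list xs))"
        by simp
    qed
    also have "\<dots> = (\<Sum>\<mu>\<in>\<Lambda>. smul (\<Prod>(i, \<nu>)\<leftarrow>zip w (replicate d \<mu>). coef i \<nu>) (E (of_nat d * \<mu>)))"
    proof -
      have "inj_on (replicate d) \<Lambda>" using d0 by (auto simp: inj_on_def)
      then show ?thesis by (simp add: sum.reindex sum_list_replicate)
    qed
    also have "\<dots> = g"
      unfolding g_sum
    proof (rule sum.cong[OF refl])
      fix \<mu> assume "\<mu> \<in> \<Lambda>"
      then have "(\<Prod>(i, \<nu>)\<leftarrow>zip w (replicate (length w) \<mu>). coef i \<nu>) = h \<mu> ^ length w"
        by (intro prod_zip_replicate_const) (simp add: coef_def)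
      then show "smul (\<Prod>(i, \<nu>)\<leftarrow>zip w (replicate d \<mu>). coef i \<nu>) (E (of_nat d * \<mu>)) =
          smul (b (of_nat d * \<mu>)) (E (of_nat d * \<mu>))"
        using h[of \<mu>] unfolding d_def by simp
    qed
    finally have "(\<lambda>n. (T ^^ n) (prod_nonempty (map (f n) w))) \<longlonglongrightarrow> g"
      using orbit[OF ne(1)] by (simp add: L_def d_def)
    then show ?thesis
      using V(1) g(1) by (rule topological_tendstoD)
  qed
  obtain n where "f n \<in> W" "(T ^^ n) (prod_nonempty (map (f n) w)) \<in> V"
      "\<forall>v\<in>S. (T ^^ n) (prod_nonempty (map (f n) v)) \<in> Z"
    using eventually_happens'[OF sequentially_bot eventually_conj[OF ev_W eventually_conj[OF ev_V ev_S]]] by blast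
  then show ?thesis by blast
qed

end

section \<open>Generic properties in completely metrizable spaces\<close>

lemma dense_set_iff: "dense_set X \<longleftrightarrow> (\<forall>W. open W \<longrightarrow> W \<noteq> {} \<longrightarrow> (\<exists>x\<in>X. x \<in> W))"
proof -
  have "closure X = UNIV \<longleftrightarrow> (\<forall>W. open W \<and> W \<noteq> {} \<longrightarrow> X \<inter> W \<noteq> {})"
    using dense_intersects_open[of euclidean X] by simp
  then show ?thesis unfolding dense_set_def by blast
qed

lemma generically_countable_intersection:
  fixes Q :: "'b :: topological_space \<Rightarrow> bool"
  assumes compl: "completely_metrizable_space (euclidean :: 'b topology)"
    and count: "countable \<G>" and \<G>: "\<And>X. X \<in> \<G> \<Longrightarrow> open X \<and> dense_set X"
    and Q: "\<And>x. (\<And>X. X \<in> \<G> \<Longrightarrow> x \<in> X) \<Longrightarrow> Q x"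
  shows "generically Q"
proof -
  let ?\<H> = "insert UNIV \<G>"
  have "gdelta_in euclidean (\<Inter>?\<H>)"
    by (rule gdelta_in_Inter) (use count \<G> in \<open>auto intro: open_imp_gdelta_in\<close>)
  moreover have "euclidean closure_of \<Inter>?\<H> = topspace euclidean"
    using compl count \<G> by (intro Baire_category) (auto simp: dense_set_def)
  ultimately show ?thesis
    unfolding generically_def using Q by (intro exI[of _ "\<Inter>?\<H>"]) (auto simp: dense_set_def)
qed

lemma separable_metric_countable_base:
  fixes d :: "'b :: topological_space \<Rightarrow> 'b \<Rightarrow> real"
  assumes "separable_space (euclidean :: 'b topology)"
    and d: "Metric_space UNIV d" "Metric_space.mtopology UNIV d = (euclidean :: 'b topology)"
  obtains B :: "'b set set" where "countable B" "\<forall>V\<in>B. open V"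
    "\<forall>U x. open U \<and> x \<in> U \<longrightarrow> (\<exists>V\<in>B. x \<in> V \<and> V \<subseteq> U)"
proof -
  interpret Metric_space UNIV d by (rule d(1))
  obtain C :: "'b set" where C: "countable C" "closure C = UNIV"
    using assms(1) unfolding separable_space_def by auto
  define B where "B = (\<lambda>(c, n). mball c (inverse (real (Suc n)))) ` (C \<times> UNIV)"
  have "\<exists>V\<in>B. x \<in> V \<and> V \<subseteq> U" if U: "open U" "x \<in> U" for U x
  proof -
    have "openin mtopology U" using U(1) d(2) by simp
    then obtain r where r: "r > 0" "mball x r \<subseteq> U"
      using U(2) unfolding openin_mtopology by blast
    then obtain n where n: "inverse (real (Suc n)) < r / 2"
      using reals_Archimedean[of "r / 2"] by auto
    have "open (mball x (inverse (real (Suc n))))"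
      using openin_mball[of x] d(2) by simp
    moreover have "x \<in> mball x (inverse (real (Suc n)))" by simp
    ultimately obtain c where c: "c \<in> C" "c \<in> mball x (inverse (real (Suc n)))"
      using C(2) dense_set_iff[of C] unfolding dense_set_def by blast
    have "mball c (inverse (real (Suc n))) \<subseteq> mball x r"
    proof
      fix y assume "y \<in> mball c (inverse (real (Suc n)))"
      then show "y \<in> mball x r" using c(2) n triangle[of x c y] by simp
    qed
    moreover have "x \<in> mball c (inverse (real (Suc n)))"
      using c(2) by (simp add: commute)
    ultimately show ?thesis
      using c(1) r(2) unfolding B_def by (intro bexI[of _ "mball c (inverse (real (Suc n)))"]) auto
  qed
  moreover have "\<forall>V\<in>B. open V"
    using openin_mball d(2) by (auto simp: B_def)
  moreover have "countable B" using C(1) by (simp add: B_def)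
  ultimately show ?thesis using that[of B] by blast
qed

context F_space
begin

lemma completely_metrizable: "completely_metrizable_space (euclidean :: 'a topology)"
  using complete_invariant_metric unfolding completely_metrizable_space_def by metis

lemma closed_singleton: "closed {x :: 'a}"
proof -
  have "t1_space (euclidean :: 'a topology)"
    using completely_metrizable completely_metrizable_imp_metrizable_space metrizable_imp_t1_space by blast
  then show ?thesis by (simp add: t1_space_closedin_singleton)
qed

lemma completely_metrizable_sequences: "completely_metrizable_space (euclidean :: (nat \<Rightarrow> 'a) topology)"
  using completely_metrizable completely_metrizable_space_product_topology[of "\<lambda>_::nat. euclidean :: 'a topology" UNIV]
  by (simp add: euclidean_product_topology)

end

section \<open>The leading monomial of a polynomial\<close>

lemma sum_list_word:
  fixes l :: "nat \<Rightarrow> real"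
  shows "(\<Sum>i\<leftarrow>concat (map (\<lambda>j. replicate (m j) (c j)) js). l i) = (\<Sum>j\<leftarrow>js. m j * l (c j))"
  by (induction js) (auto simp: sum_list_replicate)

text \<open>
The word of the monomial with exponent vector \<open>m\<close> whose \<open>j\<close>-th variable is replaced by the entry with
index \<open>js ! j\<close> of a sequence.
\<close>

definition monomial_word :: "nat list \<Rightarrow> (nat \<Rightarrow>\<^sub>0 nat) \<Rightarrow> nat list" where
  "monomial_word js m = concat (map (\<lambda>j. replicate (Poly_Mapping.lookup m j) (js ! j)) [0..<length js])"

lemma eval_monomial_word:
  "eval_monomial (map f js) m = prod_nonempty (map f (monomial_word js m))"
proof -
  have "map (\<lambda>i. replicate (Poly_Mapping.lookup m i) (map f js ! i)) [0..<length (map f js)] =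
      map (map f \<circ> (\<lambda>j. replicate (Poly_Mapping.lookup m j) (js ! j))) [0..<length js]"
    by (auto simp: map_replicate)
  then show ?thesis
    unfolding eval_monomial_def monomial_word_def map_concat map_map by (simp only:)
qed

lemma sum_list_monomial_word:
  fixes l :: "nat \<Rightarrow> real"
  shows "(\<Sum>i\<leftarrow>monomial_word js m. l i) = (\<Sum>j<length js. Poly_Mapping.lookup m j * l (js ! j))"
  unfolding monomial_word_def sum_list_word by (simp add: interv_sum_list_conv_sum_set_nat atLeast0LessThan)

lemma length_monomial_word: "length (monomial_word js m) = (\<Sum>j<length js. Poly_Mapping.lookup m j)"
  unfolding monomial_word_def
  by (simp add: length_concat o_def interv_sum_list_conv_sum_set_nat atLeast0LessThan)

text \<open>
Among the exponent vectors of maximal degree in \<open>P\<close>, one of maximal Euclidean norm is a vertex of their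
convex hull, and it is exposed by the functional that it defines itself: from \<open>\<bar>m - \<alpha>\<bar>\<^sup>2 > 0\<close> and
\<open>\<bar>m\<bar> \<le> \<bar>\<alpha>\<bar>\<close> one gets \<open>\<langle>m, \<alpha>\<rangle> < \<bar>\<alpha>\<bar>\<^sup>2\<close>.
\<close>

lemma leading_monomial_dominates:
  assumes "distinct js" and P: "P \<in> polys_without_constant_term (length js)" "P \<noteq> 0"
  obtains \<alpha> where "\<alpha> \<in> Poly_Mapping.keys P"
    "dominates (monomial_word js \<alpha>) (monomial_word js ` (Poly_Mapping.keys P - {\<alpha>}))"
proof -
  let ?K = "Poly_Mapping.keys P" and ?k = "length js"
  define deg where "deg m = length (monomial_word js m)" for m
  define sq where "sq m = (\<Sum>j<?k. (Poly_Mapping.lookup m j)\<^sup>2)" for m :: "nat \<Rightarrow>\<^sub>0 nat"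
  have finK: "finite ?K" and neK: "?K \<noteq> {}" using P(2) by auto
  define K1 where "K1 = {m \<in> ?K. deg m = Max (deg ` ?K)}"
  have "finite K1" using finK by (simp add: K1_def)
  moreover have "K1 \<noteq> {}"
  proof -
    have "Max (deg ` ?K) \<in> deg ` ?K" using finK neK by (intro Max_in) auto
    then obtain m where "Max (deg ` ?K) = deg m" "m \<in> ?K" by (rule imageE)
    then have "m \<in> K1" unfolding K1_def by (intro CollectI conjI) simp_all
    then show ?thesis by blast
  qed
  ultimately have "Max (sq ` K1) \<in> sq ` K1" by (intro Max_in) auto
  then obtain \<alpha> where \<alpha>: "\<alpha> \<in> K1" "sq \<alpha> = Max (sq ` K1)" by auto
  have \<alpha>K: "\<alpha> \<in> ?K" and deg_le: "\<And>m. m \<in> ?K \<Longrightarrow> deg m \<le> deg \<alpha>"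
    using \<alpha>(1) finK by (auto simp: K1_def)
  have sq_le: "sq m \<le> sq \<alpha>" if "m \<in> ?K" "deg m = deg \<alpha>" for m
    using that \<alpha> \<open>finite K1\<close> by (auto simp: K1_def intro: Max_ge)
  have keys: "Poly_Mapping.keys m \<subseteq> {..<?k}" if "m \<in> ?K" for m
    using P(1) that by (auto simp: polys_without_constant_term_def)
  have ne: "monomial_word js m \<noteq> []" if m: "m \<in> ?K" for m
  proof -
    have "m \<noteq> 0" using P(1) m by (auto simp: polys_without_constant_term_def in_keys_iff)
    then obtain j where j: "j \<in> Poly_Mapping.keys m" by (metis keys_eq_empty ex_in_conv)
    then have "Poly_Mapping.lookup m j > 0" by (simp add: in_keys_iff)
    moreover have "j < ?k" using keys[OF m] j by blast
    ultimately have "deg m > 0"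
      unfolding deg_def length_monomial_word by (intro sum_pos2[of _ j]) auto
    then show ?thesis by (simp add: deg_def)
  qed
  \<comment> \<open>each index in \<open>js\<close> is weighted with the exponent that \<open>\<alpha>\<close> gives to it\<close>
  define l where "l i = real (Poly_Mapping.lookup \<alpha> (inv_into {..<?k} ((!) js) i))" for i
  have l: "l (js ! j) = Poly_Mapping.lookup \<alpha> j" if "j < ?k" for j
    using that inj_on_nth[OF assms(1), of "{..<?k}"] by (simp add: l_def)
  have sum_l: "(\<Sum>i\<leftarrow>monomial_word js m. l i) =
      (\<Sum>j<?k. real (Poly_Mapping.lookup m j) * real (Poly_Mapping.lookup \<alpha> j))" for m
    unfolding sum_list_monomial_word by (intro sum.cong) (auto simp: l)
  have less: "(\<Sum>i\<leftarrow>monomial_word js m. l i) < (\<Sum>i\<leftarrow>monomial_word js \<alpha>. l i)"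
    if m: "m \<in> ?K" "m \<noteq> \<alpha>" "deg m = deg \<alpha>" for m
  proof -
    obtain j where j: "Poly_Mapping.lookup m j \<noteq> Poly_Mapping.lookup \<alpha> j"
      using m(2) by (metis poly_mapping_eqI)
    have "j < ?k"
    proof (rule ccontr)
      assume "\<not> j < ?k"
      then have "j \<notin> Poly_Mapping.keys m" "j \<notin> Poly_Mapping.keys \<alpha>"
        using keys m(1) \<alpha>K by auto
      then show False using j by (simp add: in_keys_iff)
    qed
    then have "0 < (\<Sum>j<?k. (real (Poly_Mapping.lookup m j) - real (Poly_Mapping.lookup \<alpha> j))\<^sup>2)"
      using j by (intro sum_pos2[of _ j]) auto
    also have "\<dots> = real (sq m) + real (sq \<alpha>) -
        2 * (\<Sum>j<?k. real (Poly_Mapping.lookup m j) * real (Poly_Mapping.lookup \<alpha> j))"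
      by (simp add: sq_def power2_diff sum.distrib sum_subtractf sum_distrib_left mult.assoc)
    finally have "(\<Sum>j<?k. real (Poly_Mapping.lookup m j) * real (Poly_Mapping.lookup \<alpha> j)) < real (sq \<alpha>)"
      using sq_le[OF m(1,3)] by simp
    then show ?thesis
      unfolding sum_l by (simp add: sq_def power2_eq_square)
  qed
  have "dominates (monomial_word js \<alpha>) (monomial_word js ` (?K - {\<alpha>}))"
    unfolding dominates_def
  proof (intro conjI exI[of _ l] ballI)
    show "monomial_word js \<alpha> \<noteq> []" by (rule ne[OF \<alpha>K])
    show "finite (monomial_word js ` (?K - {\<alpha>}))" using finK by simp
    fix v assume "v \<in> monomial_word js ` (?K - {\<alpha>})"
    then obtain m where m: "m \<in> ?K" "m \<noteq> \<alpha>" "v = monomial_word js m" by blast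
    show "v \<noteq> []" using ne m by simp
    show "length v < length (monomial_word js \<alpha>) \<or>
        length v = length (monomial_word js \<alpha>) \<and> (\<Sum>i\<leftarrow>v. l i) < (\<Sum>i\<leftarrow>monomial_word js \<alpha>. l i)"
      using deg_le[OF m(1)] less[OF m(1,2)] m(3) by (auto simp: deg_def le_less)
  qed
  then show ?thesis using that \<alpha>K by blast
qed

section \<open>Hypercyclicity of the generated algebra\<close>

context exponential_eigenvectors
begin

text \<open>
The property of the generic sequence that everything else is derived from. It speaks about words
only, and there are countably many of them, whereas the polynomials form an uncountable family.
\<close>

definition separating_orbits :: "(nat \<Rightarrow> 'a) \<Rightarrow> bool" where
  "separating_orbits f \<longleftrightarrow> (\<forall>w S V Z. dominates w S \<and> open V \<and> V \<noteq> {} \<and> open Z \<and> 0 \<in> Z \<longrightarrow>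
     (\<exists>n. (T ^^ n) (prod_nonempty (map f w)) \<in> V \<and> (\<forall>v\<in>S. (T ^^ n) (prod_nonempty (map f v)) \<in> Z)))"

text \<open>
The map \<open>y \<mapsto> \<Sum>c(m) y(m)\<close> is continuous and takes the value \<open>u\<close> at the point that is \<open>u / c(\<alpha>)\<close> in the
coordinate \<open>\<alpha>\<close> and zero elsewhere. So it suffices that some iterate brings the leading monomial close
to \<open>u / c(\<alpha>)\<close> and all the others close to zero.
\<close>

lemma combination_hypercyclic:
  fixes K :: "'m set" and word :: "'m \<Rightarrow> nat list"
  assumes f: "separating_orbits f" and K: "finite K" "\<alpha> \<in> K" and c: "c \<alpha> \<noteq> 0"
    and dom: "dominates (word \<alpha>) (word ` (K - {\<alpha>}))"
  shows "hypercyclic T (\<Sum>m\<in>K. smul (c m) (prod_nonempty (map f (word m))))"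
  unfolding hypercyclic_def dense_set_iff
proof (intro allI impI)
  fix U :: "'a set" assume U: "open U" "U \<noteq> {}"
  then obtain u where u: "u \<in> U" by blast
  define \<Phi> where "\<Phi> y = (\<Sum>m\<in>K. smul (c m) (y m))" for y :: "'m \<Rightarrow> 'a"
  define y0 where "y0 m = (if m = \<alpha> then smul (1 / c \<alpha>) u else 0)" for m
  have "\<Phi> y0 = (\<Sum>m\<in>K. if m = \<alpha> then u else 0)"
    unfolding \<Phi>_def y0_def using c by (intro sum.cong) auto
  then have "\<Phi> y0 = u" using K by simp
  have "continuous_on UNIV \<Phi>"
    unfolding continuous_on_def \<Phi>_def
    by (intro ballI tendsto_vec_sum tendsto_smul tendsto_const)
      (metis continuous_on_def continuous_on_product_coordinates UNIV_I)
  then have "open (\<Phi> -` U)" using U(1) by (rule open_vimage[rotated])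
  moreover have "y0 \<in> \<Phi> -` U" using u \<open>\<Phi> y0 = u\<close> by simp
  ultimately obtain X where X: "y0 \<in> PiE UNIV X" "\<And>m. open (X m)" "PiE UNIV X \<subseteq> \<Phi> -` U"
    using product_topology_open_contains_basis[of "\<lambda>_. euclidean" UNIV "\<Phi> -` U" y0]
    unfolding open_fun_def by auto
  have "open (\<Inter>m\<in>K - {\<alpha>}. X m)" using K X(2) by (intro open_INT) auto
  moreover have "0 \<in> (\<Inter>m\<in>K - {\<alpha>}. X m)" using X(1) by (auto simp: y0_def PiE_def Pi_def split: if_splits)
  moreover have "X \<alpha> \<noteq> {}" using X(1) by auto
  ultimately obtain n where n: "(T ^^ n) (prod_nonempty (map f (word \<alpha>))) \<in> X \<alpha>"
      "\<forall>v\<in>word ` (K - {\<alpha>}). (T ^^ n) (prod_nonempty (map f v)) \<in> (\<Inter>m\<in>K - {\<alpha>}. X m)"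
    using f dom X(2)[of \<alpha>] unfolding separating_orbits_def by blast
  \<comment> \<open>outside \<open>K\<close> the point only has to stay in the basic neighbourhood \<open>X\<close>\<close>
  define y where "y m = (if m \<in> K then (T ^^ n) (prod_nonempty (map f (word m))) else y0 m)" for m
  have "y m \<in> X m" for m
    using n X(1) by (cases "m = \<alpha>"; cases "m \<in> K") (auto simp: y_def)
  then have "\<Phi> y \<in> U" using X(3) by auto
  moreover have "\<Phi> y = (T ^^ n) (\<Sum>m\<in>K. smul (c m) (prod_nonempty (map f (word m))))"
    unfolding \<Phi>_def y_def
    using linear_iterate[of n] by (simp add: module_hom.sum[OF linear_iterate] module_hom.scale[OF linear_iterate])
  ultimately show "\<exists>x\<in>{(T ^^ n) (\<Sum>m\<in>K. smul (c m) (prod_nonempty (map f (word m)))) |n. True}. x \<in> U"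
    by auto
qed

lemma zero_not_hypercyclic:
  assumes "(x :: 'a) \<noteq> 0"
  shows "\<not> hypercyclic T 0"
proof
  assume "hypercyclic T 0"
  moreover have "{(T ^^ n) 0 |n. True} = {0}"
    using module_hom.zero[OF linear_iterate] by auto
  ultimately have "closure {0 :: 'a} = UNIV" by (simp add: hypercyclic_def dense_set_def)
  then show False using assms closure_closed[OF closed_singleton[of 0]] by auto
qed

lemma polynomial_hypercyclic:
  assumes f: "separating_orbits f" and js: "distinct js"
    and P: "P \<in> polys_without_constant_term (length js)" "P \<noteq> 0"
  shows "hypercyclic T (eval_cpoly smul P (map f js))"
proof -
  obtain \<alpha> where \<alpha>: "\<alpha> \<in> Poly_Mapping.keys P"
    "dominates (monomial_word js \<alpha>) (monomial_word js ` (Poly_Mapping.keys P - {\<alpha>}))"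
    by (rule leading_monomial_dominates[OF js P])
  then show ?thesis
    unfolding eval_cpoly_def eval_monomial_word
    by (intro combination_hypercyclic[OF f]) (auto simp: in_keys_iff)
qed

text \<open>
The difference of two entries with distinct indices is hypercyclic, hence nonzero.
\<close>

lemma separating_orbits_inj:
  assumes f: "separating_orbits f" and "(x :: 'a) \<noteq> 0"
  shows "inj f"
proof (rule injI, rule ccontr)
  fix i j assume ij: "f i = f j" "i \<noteq> j"
  have "dominates [i] {[j]}"
    unfolding dominates_def using ij(2) by (auto intro!: exI[of _ "\<lambda>m. if m = i then 1 else 0"])
  moreover have "(\<lambda>m. [m]) ` ({i, j} - {i}) = {[j]}" using ij(2) by auto
  ultimately have "hypercyclic T (\<Sum>m\<in>{i, j}. smul (if m = i then 1 else - 1) (prod_nonempty (map f [m])))"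
    by (intro combination_hypercyclic[OF f, where \<alpha> = i]) auto
  moreover have "(\<Sum>m\<in>{i, j}. smul (if m = i then 1 else - 1) (prod_nonempty (map f [m]))) = 0"
    using ij by (simp add: scale_minus_left)
  ultimately show False using zero_not_hypercyclic[OF assms(2)] by simp
qed

text \<open>
Letting \<open>V\<close> and \<open>Z\<close> range over a countable base turns both properties of \<open>f\<close> into countable intersections
of open sets, which are dense by \<open>simultaneous_orbits\<close> and by the definition of the product
topology respectively.
\<close>

lemma generically_separating_orbits:
  assumes sep: "separable_space (euclidean :: 'a topology)"
    and hol: "\<phi> holomorphic_on UNIV" and norm0: "norm (\<phi> 0) = 1"
    and curv: "deriv (deriv \<phi>) 0 * \<phi> 0 \<noteq> (deriv \<phi> 0)\<^sup>2" and slope: "deriv \<phi> 0 \<noteq> 0"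
    and dense: "\<And>U. 0 islimpt U \<Longrightarrow> closure (span (E ` U)) = UNIV"
    and Q: "\<And>f. separating_orbits f \<Longrightarrow> dense_set (range f) \<Longrightarrow> Q f"
  shows "generically Q"
proof -
  obtain d where d: "Metric_space UNIV d" "Metric_space.mtopology UNIV d = (euclidean :: 'a topology)"
    using complete_invariant_metric by blast
  obtain B :: "'a set set" where B: "countable B" "\<forall>V\<in>B. open V"
    "\<forall>U x. open U \<and> x \<in> U \<longrightarrow> (\<exists>V\<in>B. x \<in> V \<and> V \<subseteq> U)"
    by (rule separable_metric_countable_base[OF sep d])
  define steering_set where "steering_set = (\<lambda>(w, S, V, Z). {f :: nat \<Rightarrow> 'a. \<exists>n. (T ^^ n) (prod_nonempty (map f w)) \<in> V \<and>
      (\<forall>v\<in>S. (T ^^ n) (prod_nonempty (map f v)) \<in> Z)})"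
  define visiting_set where "visiting_set V = {f :: nat \<Rightarrow> 'a. \<exists>n. f n \<in> V}" for V
  define I where "I = {(w, S, V, Z). dominates w S \<and> V \<in> B - {{}} \<and> Z \<in> B \<and> 0 \<in> Z}"
  have "I \<subseteq> UNIV \<times> Collect finite \<times> B \<times> B"
    by (auto simp: I_def dominates_def)
  moreover have "countable (UNIV \<times> Collect finite \<times> B \<times> B :: (nat list \<times> nat list set \<times> 'a set \<times> 'a set) set)"
    using B(1) by (intro countable_SIGMA countableI_type countable_Collect_finite)
  ultimately have countI: "countable I" by (rule countable_subset)
  show ?thesis
  proof (rule generically_countable_intersection[OF completely_metrizable_sequences])
    show "countable (steering_set ` I \<union> visiting_set ` (B - {{}}))" using countI B(1) by simp
    show "open X \<and> dense_set X" if X: "X \<in> steering_set ` I \<union> visiting_set ` (B - {{}})" for X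
      using X
    proof
      assume "X \<in> steering_set ` I"
      then obtain w S V Z where I: "(w, S, V, Z) \<in> I" and X: "X = steering_set (w, S, V, Z)" by auto
      then have dom: "dominates w S" and V: "open V" "V \<noteq> {}" and Z: "open Z" "0 \<in> Z"
        using B(2) by (auto simp: I_def)
      have cont: "continuous_on UNIV (\<lambda>f :: nat \<Rightarrow> 'a. (T ^^ n) (prod_nonempty (map f v)))" for n v
        using continuous_on_compose2[OF continuous_iterate continuous_on_monomial] by simp
      have "X = (\<Union>n. ((\<lambda>f. (T ^^ n) (prod_nonempty (map f w))) -` V) \<inter>
          (\<Inter>v\<in>S. (\<lambda>f. (T ^^ n) (prod_nonempty (map f v))) -` Z))"
        unfolding X steering_set_def by auto
      moreover have "finite S" using dom by (simp add: dominates_def)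
      ultimately have "open X"
        by (simp add: open_UN open_Int open_INT open_vimage[OF _ cont] V(1) Z(1))
      moreover have "dense_set X"
        unfolding dense_set_iff
      proof (intro allI impI)
        fix W :: "(nat \<Rightarrow> 'a) set" assume "open W" "W \<noteq> {}"
        from simultaneous_orbits[OF hol norm0 curv slope dense dom V Z this]
        show "\<exists>f\<in>X. f \<in> W" unfolding X steering_set_def by auto
      qed
      ultimately show ?thesis by blast
    next
      assume "X \<in> visiting_set ` (B - {{}})"
      then obtain V where V: "V \<in> B" "V \<noteq> {}" and X: "X = visiting_set V" by blast
      have "X = (\<Union>n. (\<lambda>f. f n) -` V)" unfolding X visiting_set_def by auto
      moreover have "open ((\<lambda>f. f n) -` V)" for n :: nat
        using B(2) V(1) by (intro open_vimage continuous_on_product_coordinates) auto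
      ultimately have "open X" by (simp add: open_UN)
      moreover have "dense_set X"
        unfolding dense_set_iff
      proof (intro allI impI)
        fix W :: "(nat \<Rightarrow> 'a) set" assume W: "open W" "W \<noteq> {}"
        then obtain f where f: "f \<in> W" by blast
        obtain y where y: "y \<in> V" using V(2) by blast
        \<comment> \<open>a basic neighbourhood of \<open>f\<close> does not restrict the entries with large index\<close>
        have "(\<lambda>n. f(n := y)) \<longlonglongrightarrow> f"
        proof (rule tendsto_fun_componentwise)
          fix i
          have "\<forall>\<^sub>F n in sequentially. f i = (f(n := y)) i"
            using eventually_gt_at_top[of i] by eventually_elim simp
          then show "(\<lambda>n. (f(n := y)) i) \<longlonglongrightarrow> f i"
            by (rule Lim_transform_eventually[OF tendsto_const])
        qed
        then have "\<forall>\<^sub>F n in sequentially. f(n := y) \<in> W"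
          using W(1) f by (rule topological_tendstoD)
        then obtain n where "f(n := y) \<in> W" using eventually_happens'[OF sequentially_bot] by blast
        moreover have "f(n := y) \<in> X" unfolding X visiting_set_def using y by (auto intro!: exI[of _ n])
        ultimately show "\<exists>f\<in>X. f \<in> W" by blast
      qed
      ultimately show ?thesis by blast
    qed
    show "Q f" if f: "\<And>X. X \<in> steering_set ` I \<union> visiting_set ` (B - {{}}) \<Longrightarrow> f \<in> X" for f
    proof (rule Q)
      show "separating_orbits f"
        unfolding separating_orbits_def
      proof (intro allI impI, elim conjE)
        fix w S and V Z :: "'a set"
        assume dom: "dominates w S" and V: "open V" "V \<noteq> {}" and Z: "open Z" "0 \<in> Z"
        obtain x where "x \<in> V" using V(2) by blast
        then obtain V' where V': "V' \<in> B" "x \<in> V'" "V' \<subseteq> V" using B(3) V(1) by blast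
        obtain Z' where Z': "Z' \<in> B" "0 \<in> Z'" "Z' \<subseteq> Z" using B(3) Z by blast
        have "(w, S, V', Z') \<in> I" using dom V' Z' by (auto simp: I_def)
        then have "f \<in> steering_set (w, S, V', Z')" using f by blast
        then show "\<exists>n. (T ^^ n) (prod_nonempty (map f w)) \<in> V \<and> (\<forall>v\<in>S. (T ^^ n) (prod_nonempty (map f v)) \<in> Z)"
          using V'(3) Z'(3) unfolding steering_set_def by auto
      qed
      show "dense_set (range f)"
        unfolding dense_set_iff
      proof (intro allI impI)
        fix U :: "'a set" assume "open U" "U \<noteq> {}"
        then obtain V where V: "V \<in> B" "V \<noteq> {}" "V \<subseteq> U" using B(3) by blast
        then have "f \<in> visiting_set V" using f by blast
        then show "\<exists>x\<in>range f. x \<in> U" using V(3) unfolding visiting_set_def by blast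
      qed
    qed
  qed
qed

end

lemma single_nonzero: "b \<noteq> 0 \<Longrightarrow> Poly_Mapping.single a b \<noteq> 0"
  by (metis lookup_single_eq lookup_zero)

lemma variable_without_constant_term:
  "Poly_Mapping.single (Poly_Mapping.single 0 1) 1 \<in> polys_without_constant_term (Suc 0)"
  using single_nonzero[of "1::nat" "0::nat"]
  by (auto simp: polys_without_constant_term_def lookup_single when_def split: if_splits)

lemma generator_in_subalgebra:
  assumes "\<And>x. smul 1 x = x" "x \<in> S"
  shows "x \<in> generated_subalgebra smul S"
proof -
  have "eval_cpoly smul (Poly_Mapping.single (Poly_Mapping.single 0 1) 1) [x] = x"
    using assms(1) by (simp add: eval_cpoly_def eval_monomial_def)
  then show ?thesis
    unfolding generated_subalgebra_def using assms(2) variable_without_constant_term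
    by (intro CollectI exI[of _ "Poly_Mapping.single (Poly_Mapping.single 0 1) 1"] exI[of _ "[x]"]) auto
qed

lemma free_generator_nonzero:
  assumes "\<And>x. smul 1 x = x" "free_generators smul S" "x \<in> S"
  shows "x \<noteq> 0"
proof -
  let ?P = "Poly_Mapping.single (Poly_Mapping.single 0 1) 1 :: cpoly"
  have "eval_cpoly smul ?P [x] = x"
    using assms(1) by (simp add: eval_cpoly_def eval_monomial_def)
  moreover have "?P \<noteq> 0" by (rule single_nonzero) simp
  then have "eval_cpoly smul ?P [x] \<noteq> 0"
    using assms(2,3) variable_without_constant_term unfolding free_generators_def
    by (metis distinct_singleton empty_subsetI insert_subset length_Cons list.set(1,2) list.size(3))
  ultimately show ?thesis by simp
qed

context exponential_eigenvectors
begin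

lemma separating_orbits_freely_generate:
  assumes f: "separating_orbits f" and x: "(x :: 'a) \<noteq> 0"
  shows "freely_generates smul f"
    "y \<in> generated_subalgebra smul (range f) \<Longrightarrow> y \<noteq> 0 \<Longrightarrow> hypercyclic T y"
proof -
  have hyp: "hypercyclic T (eval_cpoly smul P gs)"
    if gs: "distinct gs" "set gs \<subseteq> range f" and P: "P \<in> polys_without_constant_term (length gs)" "P \<noteq> 0" for gs P
  proof -
    have "set gs \<subseteq> f ` UNIV" by (rule gs(2))
    then have js: "gs = map f (map (inv f) gs)" by (auto simp: f_inv_into_f intro!: map_idI[symmetric])
    define js where "js = map (inv f) gs"
    have "distinct js" "length js = length gs" "gs = map f js"
      using js gs(1) inj_on_inv_into[OF gs(2)] by (auto simp: js_def distinct_map)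
    then show ?thesis using polynomial_hypercyclic[OF f, of js P] P by simp
  qed
  have "free_generators smul (range f)"
    unfolding free_generators_def using hyp zero_not_hypercyclic[OF x] by metis
  then show "freely_generates smul f"
    unfolding freely_generates_def using separating_orbits_inj[OF f x] by blast
  assume "y \<in> generated_subalgebra smul (range f)" "y \<noteq> 0"
  then obtain P gs where P: "y = eval_cpoly smul P gs" "distinct gs" "set gs \<subseteq> range f"
      "P \<in> polys_without_constant_term (length gs)"
    unfolding generated_subalgebra_def by blast
  moreover have "P \<noteq> 0" using P(1) \<open>y \<noteq> 0\<close> by (auto simp: eval_cpoly_def)
  ultimately show "hypercyclic T y" using hyp by blast
qed

end


theorem theorem4p2:
  fixes smul :: "complex \<Rightarrow> 'a \<Rightarrow> 'a :: {comm_ring, topological_space}"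
    and T :: "'a \<Rightarrow> 'a"
    and E :: "complex \<Rightarrow> 'a"
    and \<phi> :: "complex \<Rightarrow> complex"
  assumes "commutative_F_algebra smul"
    and "separable_space (euclidean :: 'a topology)"
    and "\<exists>A. freely_generated_subalgebra smul A \<and> dense_set A"
    and "continuous_operator smul T"
    and "\<phi> holomorphic_on UNIV"
    and "\<And>z. T (E z) = smul (\<phi> z) (E z)"
    and "\<And>z w. E z * E w = E (z + w)"
    and "\<And>\<Lambda>. (\<exists>a. a islimpt \<Lambda>) \<Longrightarrow> dense_set (module.span smul (E ` \<Lambda>))"
    and "norm (\<phi> 0) = 1"
    and "deriv (deriv \<phi>) 0 * \<phi> 0 \<noteq> (deriv \<phi> 0)\<^sup>2"
    and "deriv \<phi> 0 \<noteq> 0"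
  shows "generically (\<lambda>f :: nat \<Rightarrow> 'a.
           freely_generates smul f
           \<and> dense_set (generated_subalgebra smul (range f))
           \<and> (\<forall>x \<in> generated_subalgebra smul (range f) - {0}. hypercyclic T x))"
proof -
  interpret commutative_F_algebra smul by (rule assms(1))
  interpret exponential_eigenvectors smul T E \<phi>
    by unfold_locales (rule assms)+
  obtain S where "S \<noteq> {}" "free_generators smul S"
    using assms(3) unfolding freely_generated_subalgebra_def by blast
  then obtain x :: 'a where x: "x \<noteq> 0"
    using free_generator_nonzero[of smul S] by auto
  show ?thesis
  proof (rule generically_separating_orbits[OF assms(2,5,9,10,11)])
    show "closure (span (E ` U)) = UNIV" if "0 islimpt U" for U
      using assms(8)[of U] that unfolding dense_set_def by blast
    fix f :: "nat \<Rightarrow> 'a"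
    assume f: "separating_orbits f" and range: "dense_set (range f)"
    have "range f \<subseteq> generated_subalgebra smul (range f)"
      by (intro subsetI generator_in_subalgebra) auto
    then have "dense_set (generated_subalgebra smul (range f))"
      using range unfolding dense_set_iff by (meson subsetD)
    then show "freely_generates smul f \<and> dense_set (generated_subalgebra smul (range f))
        \<and> (\<forall>x\<in>generated_subalgebra smul (range f) - {0}. hypercyclic T x)"
      using separating_orbits_freely_generate[OF f x] by simp
  qed
qed

end
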